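(* Let $n\ge 3$, let $k$ be a field, let $M\supset k$ be an infinite field, and let $\mathbf a,\mathbf b\in M^n$ be such that $f_n(\mathbf a;X)$ and $f_n(\mathbf b;X)$ both have no multiple root. Fix $j$ with $0\le j\le n-1$ and assume that the polynomial $F_j(\mathbf a,\mathbf b;X)\in M[X]$ (of degree $n!$) has no multiple root. Then $F_j(\mathbf a,\mathbf b;X)$ has a root in $M$ if and only if $M[X]/(f_n(\mathbf a;X))$ and $M[X]/(f_n(\mathbf b;X))$ are isomorphic as $M$-algebras.
   Context: For $\mathbf a=(a_1,\ldots,a_n)\in M^n$ put $f_n(\mathbf a;X)=X^n-a_1X^{n-1}+a_2X^{n-2}-\cdots+(-1)^na_n$. Let $\alpha_1,\ldots,\alpha_n$ and $\beta_1,\ldots,\beta_n$ be the roots of $f_n(\mathbf a;X)$ and $f_n(\mathbf b;X)$ in a fixed algebraic closure of $M$, in a fixed order. For $\tau\in\mathfrak S_n$ let $(c_0^{\tau},\ldots,c_{n-1}^{\tau})$ be the unique solution of the Vandermonde system $\beta_{\tau(i)}=c_0^{\tau}+c_1^{\tau}\alpha_i+\cdots+c_{n-1}^{\tau}\alpha_i^{n-1}$ ($i=1,\ldots,n$). Define $F_j(\mathbf a,\mathbf b;X)=\prod_{\tau\in\mathfrak S_n}(X-c_j^{\tau})$; it has coefficients in $M$ and does not depend on the ordering of the roots. *)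

theory Defs
  imports
    "HOL-Algebra.QuotRing"
    "HOL-Algebra.Subrings"
    "HOL-Algebra.Algebraic_Closure_Type"
    "HOL-Combinatorics.Permutations"
begin

text \<open>The tuple \<open>(a 1, ..., a n)\<close> is a function on \<open>nat\<close>; its values outside \<open>{1..n}\<close> are
  irrelevant.\<close>

definition f_poly :: "nat \<Rightarrow> (nat \<Rightarrow> 'm::field) \<Rightarrow> 'm poly" where
  "f_poly n a = Polynomial.monom 1 n
     + (\<Sum>i = 1..n. Polynomial.monom ((- 1) ^ i * a i) (n - i))"

text \<open>Multiplicities of roots are taken in the algebraic closure of the coefficient field.\<close>

definition no_multiple_root :: "'m::field poly \<Rightarrow> bool" where
  "no_multiple_root p \<longleftrightarrow> rsquarefree (map_poly to_ac p)"

definition roots_enum :: "nat \<Rightarrow> 'm::field poly \<Rightarrow> (nat \<Rightarrow> 'm alg_closure) \<Rightarrow> bool" where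
  "roots_enum n p \<alpha> \<longleftrightarrow> map_poly to_ac p = (\<Prod>i = 1..n. [:- \<alpha> i, 1:])"

text \<open>Extensionality pins the solution down outside the index range, so that it is unique
  as a function whenever \<open>\<alpha> 1, ..., \<alpha> n\<close> are distinct.\<close>

definition vandermonde_sol ::
  "nat \<Rightarrow> (nat \<Rightarrow> 'c::field) \<Rightarrow> (nat \<Rightarrow> 'c) \<Rightarrow> (nat \<Rightarrow> nat) \<Rightarrow> nat \<Rightarrow> 'c" where
  "vandermonde_sol n \<alpha> \<beta> \<tau> = (THE c. c \<in> extensional {..<n} \<and>
     (\<forall>i\<in>{1..n}. \<beta> (\<tau> i) = (\<Sum>m<n. c m * \<alpha> i ^ m)))"

definition F_closure ::
  "nat \<Rightarrow> nat \<Rightarrow> (nat \<Rightarrow> 'c::field) \<Rightarrow> (nat \<Rightarrow> 'c) \<Rightarrow> 'c poly" where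
  "F_closure n j \<alpha> \<beta> = (\<Prod>\<tau> | \<tau> permutes {1..n}. [:- vandermonde_sol n \<alpha> \<beta> \<tau> j, 1:])"

text \<open>\<^term>\<open>F_closure\<close> read as a polynomial over the base field. When \<open>\<alpha>\<close> and \<open>\<beta>\<close> enumerate the
  roots of polynomials over the base field without multiple roots, its coefficients lie in the
  base field, since automorphisms of the closure permute the factors; as \<^term>\<open>to_ac\<close> is
  injective, the description is then definite.\<close>

definition F_poly ::
  "nat \<Rightarrow> nat \<Rightarrow> (nat \<Rightarrow> 'm::field alg_closure) \<Rightarrow> (nat \<Rightarrow> 'm alg_closure) \<Rightarrow> 'm poly" where
  "F_poly n j \<alpha> \<beta> = (THE F. map_poly to_ac F = F_closure n j \<alpha> \<beta>)"

text \<open>The quotient of the polynomial ring by \<open>(p)\<close>, as an algebra over the coefficient field: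
  scalars act through the classes of constant polynomials.\<close>

definition poly_quot :: "'m::field poly \<Rightarrow> ('m, 'm poly set) module" where
  "poly_quot p =
     (let P = (ring_of_type_algebra :: 'm poly ring); I = PIdl\<^bsub>P\<^esub> p; Q = P Quot I
      in ring.extend Q (module.fields (\<lambda>c A. (I +>\<^bsub>P\<^esub> [:c:]) \<otimes>\<^bsub>Q\<^esub> A)))"

definition algebra_isomorphic ::
  "'r ring \<Rightarrow> ('r, 'a) module \<Rightarrow> ('r, 'b) module \<Rightarrow> bool" where
  "algebra_isomorphic R A B \<longleftrightarrow>
     (\<exists>h \<in> ring_iso A B. \<forall>c \<in> carrier R. \<forall>x \<in> carrier A. h (c \<odot>\<^bsub>A\<^esub> x) = c \<odot>\<^bsub>B\<^esub> h x)"

lemma algebra_poly_quot: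
  fixes p :: "'m::field poly"
  shows "algebra (ring_of_type_algebra :: 'm ring) (poly_quot p)"
proof -
  define P where "P = (ring_of_type_algebra :: 'm poly ring)"
  define K where "K = (ring_of_type_algebra :: 'm ring)"
  define I where "I = PIdl\<^bsub>P\<^esub> p"
  define Q where "Q = P Quot I"
  define \<phi> where "\<phi> = (\<lambda>c. I +>\<^bsub>P\<^esub> [:c:])"
  interpret P: cring P unfolding P_def by (rule cring_from_type_algebra)
  interpret K: cring K unfolding K_def by (rule cring_from_type_algebra)
  interpret I: ideal I P unfolding I_def
    by (rule P.cgenideal_ideal) (simp add: P_def ring_of_type_algebra_def)
  interpret Q: cring Q
    unfolding Q_def by (rule I.quotient_is_cring) (rule P.cring_axioms)
  have hom: "(+>\<^bsub>P\<^esub>) I \<in> ring_hom P Q" unfolding Q_def by (rule I.rcos_ring_hom)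
  have const: "(\<lambda>c. [:c:]) \<in> ring_hom K P"
    by (rule ring_hom_memI) (simp_all add: K_def P_def ring_of_type_algebra_def one_pCons)
  have phi: "\<phi> \<in> ring_hom K Q"
    using ring_hom_trans[OF const hom] by (simp add: \<phi>_def comp_def)
  have closed: "\<phi> c \<in> carrier Q" if "c \<in> carrier K" for c
    using ring_hom_closed[OF phi that] .
  define A where "A = poly_quot p"
  have A: "A = \<lparr>carrier = carrier Q, monoid.mult = monoid.mult Q, one = monoid.one Q,
      ring.zero = ring.zero Q, add = ring.add Q,
      module.smult = (\<lambda>c x. \<phi> c \<otimes>\<^bsub>Q\<^esub> x)\<rparr>"
    by (simp add: A_def poly_quot_def Let_def ring.extend_def module.fields_def
        P_def I_def Q_def \<phi>_def)
  have cringA: "cring A"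
  proof (rule cringI)
    show "abelian_group A"
      by (rule abelian_groupI)
        (use Q.l_neg Q.a_inv_closed in \<open>force simp: A Q.a_ac\<close>)+
    show "comm_monoid A"
      by (rule comm_monoidI) (simp_all add: A Q.m_ac)
  qed (simp add: A Q.l_distr)
  have "algebra K A"
    by (rule algebraI)
      (use K.cring_axioms cringA closed ring_hom_add[OF phi] ring_hom_mult[OF phi]
        ring_hom_one[OF phi]
       in \<open>simp_all add: A Q.l_distr Q.r_distr Q.m_assoc\<close>)
  then show ?thesis by (simp add: A_def K_def)
qed

end

theory Submission
  imports Defs
begin

text \<open>Write \<open>c\<^sup>\<tau>\<close> for the polynomial of degree below \<open>n\<close> interpolating \<open>\<alpha> i \<mapsto> \<beta> (\<tau> i)\<close>, and \<open>d\<^sup>\<tau>\<close> for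
  the one interpolating in the opposite direction. Permuting the \<open>\<alpha> i\<close> by \<open>\<sigma>\<close> and the \<open>\<beta> i\<close> by \<open>\<tau>\<close>
  turns \<open>c\<^sup>\<pi>\<close> into the polynomial for \<open>\<tau> \<circ> \<pi> \<circ> \<sigma>\<inverse>\<close>, so polynomial expressions in the roots that are
  symmetrised over all permutations are bisymmetric and have values in the base field. No Galois
  theory is needed for this: the roots are eliminated one at a time, since a polynomial of degree
  below \<open>d\<close> that takes one value at \<open>d\<close> distinct points is constant.

  In particular \<open>F\<close> and, for any coefficient \<open>w\<close> of \<open>c\<^sup>\<tau>\<close> or \<open>d\<^sup>\<tau>\<close>, Lagrange's resolvent
  \<open>G = (\<Sum>\<rho>. w\<^sup>\<rho> \<cdot> (\<Prod>\<rho>' \<noteq> \<rho>. X - c\<^sub>j\<^sup>\<rho>'))\<close> have coefficients in the base field. If a simple root \<open>c\<^sub>j\<^sup>\<rho>\<close>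
  of \<open>F\<close> lies in the base field, then so does \<open>w\<^sup>\<rho> = G(c\<^sub>j\<^sup>\<rho>) / F'(c\<^sub>j\<^sup>\<rho>)\<close>. Hence \<open>c\<^sup>\<rho>\<close> and \<open>d\<^sup>\<rho>\<close> are
  polynomials over the base field, and substituting them gives mutually inverse isomorphisms.
  Conversely, the image of \<open>X\<close> under an isomorphism is represented by some \<open>d\<^sup>\<rho>\<close>, whose inverse
  \<open>c\<^sup>\<rho>\<close> provides the root.\<close>

section \<open>Functions generated by the coordinates of tuples of roots\<close>

text \<open>The \<open>K\<close>-algebra generated by \<open>Y\<close>, formed from functions on a
  set \<open>S\<close> of configurations rather than from field elements, so that symmetry becomes
  constancy on \<open>S\<close>. The rule \<open>cong\<close> identifies functions that agree on
  \<open>S\<close>, so values elsewhere carry no information.\<close>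

inductive_set adjoin :: "'c::field set \<Rightarrow> 'w set \<Rightarrow> ('w \<Rightarrow> 'c) set \<Rightarrow> ('w \<Rightarrow> 'c) set"
  for K :: "'c set" and S :: "'w set" and Y :: "('w \<Rightarrow> 'c) set"
where
  const: "c \<in> K \<Longrightarrow> (\<lambda>_. c) \<in> adjoin K S Y"
| gen: "y \<in> Y \<Longrightarrow> y \<in> adjoin K S Y"
| add: "f \<in> adjoin K S Y \<Longrightarrow> g \<in> adjoin K S Y \<Longrightarrow> (\<lambda>\<omega>. f \<omega> + g \<omega>) \<in> adjoin K S Y"
| mult: "f \<in> adjoin K S Y \<Longrightarrow> g \<in> adjoin K S Y \<Longrightarrow> (\<lambda>\<omega>. f \<omega> * g \<omega>) \<in> adjoin K S Y"
| cong: "f \<in> adjoin K S Y \<Longrightarrow> (\<And>\<omega>. \<omega> \<in> S \<Longrightarrow> f \<omega> = g \<omega>) \<Longrightarrow> g \<in> adjoin K S Y"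

lemma adjoin_mono: "f \<in> adjoin K S Y \<Longrightarrow> Y \<subseteq> Z \<Longrightarrow> f \<in> adjoin K S Z"
proof (induction rule: adjoin.induct)
  case (cong f g)
  then show ?case by (intro adjoin.cong[of f K S Z g]) auto
qed (auto intro: adjoin.intros)

lemma adjoin_agree:
  assumes "f \<in> adjoin K S Y" "w \<in> S" "v \<in> S" "\<And>y. y \<in> Y \<Longrightarrow> y w = y v"
  shows "f w = f v"
  using assms by (induction rule: adjoin.induct) auto

lemma degree_prod_linear:
  "finite I \<Longrightarrow> degree (\<Prod>i\<in>I. [:- (x i :: 'c::field), 1:]) = card I"
  by (subst degree_prod_eq_sum_degree) auto

locale value_field =
  fixes K :: "'c::field set" and S :: "'w set"
  assumes one_K: "1 \<in> K"
    and diff_K: "\<And>x y. x \<in> K \<Longrightarrow> y \<in> K \<Longrightarrow> x - y \<in> K"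
    and mult_K: "\<And>x y. x \<in> K \<Longrightarrow> y \<in> K \<Longrightarrow> x * y \<in> K"
    and inverse_K: "\<And>x. x \<in> K \<Longrightarrow> inverse x \<in> K"
begin

lemma zero_K: "0 \<in> K"
  using diff_K[OF one_K one_K] by simp

lemma uminus_K: "x \<in> K \<Longrightarrow> - x \<in> K"
  using diff_K[OF zero_K] by simp

lemma add_K: "x \<in> K \<Longrightarrow> y \<in> K \<Longrightarrow> x + y \<in> K"
  using diff_K[OF _ uminus_K] by simp

lemma sum_K: "(\<And>i. i \<in> I \<Longrightarrow> f i \<in> K) \<Longrightarrow> sum f I \<in> K"
  by (induction I rule: infinite_finite_induct) (auto intro: zero_K add_K)

lemma power_K: "x \<in> K \<Longrightarrow> x ^ k \<in> K"
  by (induction k) (auto intro: one_K mult_K)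

lemma poly_K: "(\<And>k. coeff p k \<in> K) \<Longrightarrow> x \<in> K \<Longrightarrow> poly p x \<in> K"
  unfolding poly_altdef by (intro sum_K mult_K power_K)

lemma adjoin_zero: "(\<lambda>_. 0) \<in> adjoin K S Y"
  by (rule adjoin.const[OF zero_K])

lemma adjoin_one: "(\<lambda>_. 1) \<in> adjoin K S Y"
  by (rule adjoin.const[OF one_K])

lemma adjoin_uminus: "f \<in> adjoin K S Y \<Longrightarrow> (\<lambda>\<omega>. - f \<omega>) \<in> adjoin K S Y"
  using adjoin.mult[OF adjoin.const[OF uminus_K[OF one_K]]] by fastforce

lemma adjoin_diff:
  "f \<in> adjoin K S Y \<Longrightarrow> g \<in> adjoin K S Y \<Longrightarrow> (\<lambda>\<omega>. f \<omega> - g \<omega>) \<in> adjoin K S Y"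
  using adjoin.add[OF _ adjoin_uminus] by fastforce

lemma adjoin_sum:
  "(\<And>i. i \<in> I \<Longrightarrow> f i \<in> adjoin K S Y) \<Longrightarrow> (\<lambda>\<omega>. \<Sum>i\<in>I. f i \<omega>) \<in> adjoin K S Y"
  by (induction I rule: infinite_finite_induct) (auto intro: adjoin_zero adjoin.add)

lemma adjoin_prod:
  "(\<And>i. i \<in> I \<Longrightarrow> f i \<in> adjoin K S Y) \<Longrightarrow> (\<lambda>\<omega>. \<Prod>i\<in>I. f i \<omega>) \<in> adjoin K S Y"
  by (induction I rule: infinite_finite_induct) (auto intro: adjoin_one adjoin.mult)

lemma adjoin_empty:
  assumes "f \<in> adjoin K S {}" "\<omega> \<in> S"
  shows "f \<omega> \<in> K"
  using assms by (induction rule: adjoin.induct) (auto intro: add_K mult_K)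

section \<open>Polynomials with coefficients among the generated functions\<close>

definition adjoin_poly :: "('w \<Rightarrow> 'c) set \<Rightarrow> ('w \<Rightarrow> 'c poly) set" where
  "adjoin_poly Y = {F. \<forall>k. (\<lambda>\<omega>. coeff (F \<omega>) k) \<in> adjoin K S Y}"

lemma adjoin_polyD: "F \<in> adjoin_poly Y \<Longrightarrow> (\<lambda>\<omega>. coeff (F \<omega>) k) \<in> adjoin K S Y"
  by (simp add: adjoin_poly_def)

lemma adjoin_poly_pCons:
  assumes "f \<in> adjoin K S Y" "F \<in> adjoin_poly Y"
  shows "(\<lambda>\<omega>. pCons (f \<omega>) (F \<omega>)) \<in> adjoin_poly Y"
  unfolding adjoin_poly_def
proof (intro CollectI allI)
  fix k
  show "(\<lambda>\<omega>. coeff (pCons (f \<omega>) (F \<omega>)) k) \<in> adjoin K S Y"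
    using assms by (cases k) (auto simp: adjoin_poly_def)
qed

lemma adjoin_poly_zero: "(\<lambda>_. 0) \<in> adjoin_poly Y"
  by (simp add: adjoin_poly_def adjoin_zero)

lemma adjoin_poly_one: "(\<lambda>_. 1) \<in> adjoin_poly Y"
  using adjoin_poly_pCons[OF adjoin_one adjoin_poly_zero] by (simp add: one_pCons)

lemma adjoin_poly_linear:
  assumes "f \<in> adjoin K S Y"
  shows "(\<lambda>\<omega>. [:- f \<omega>, 1:]) \<in> adjoin_poly Y"
  by (intro adjoin_poly_pCons adjoin_uminus adjoin_one adjoin_poly_zero assms)

lemma adjoin_poly_add:
  "F \<in> adjoin_poly Y \<Longrightarrow> G \<in> adjoin_poly Y \<Longrightarrow> (\<lambda>\<omega>. F \<omega> + G \<omega>) \<in> adjoin_poly Y"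
  by (auto simp: adjoin_poly_def intro: adjoin.add)

lemma adjoin_poly_mult:
  assumes "F \<in> adjoin_poly Y" "G \<in> adjoin_poly Y"
  shows "(\<lambda>\<omega>. F \<omega> * G \<omega>) \<in> adjoin_poly Y"
  unfolding adjoin_poly_def
proof (intro CollectI allI)
  fix k
  show "(\<lambda>\<omega>. coeff (F \<omega> * G \<omega>) k) \<in> adjoin K S Y"
    unfolding coeff_mult by (intro adjoin_sum adjoin.mult adjoin_polyD assms)
qed

lemma adjoin_poly_smult:
  assumes "f \<in> adjoin K S Y" "F \<in> adjoin_poly Y"
  shows "(\<lambda>\<omega>. smult (f \<omega>) (F \<omega>)) \<in> adjoin_poly Y"
  using assms by (auto simp: adjoin_poly_def intro: adjoin.mult)

lemma adjoin_poly_sum: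
  "(\<And>i. i \<in> I \<Longrightarrow> F i \<in> adjoin_poly Y) \<Longrightarrow> (\<lambda>\<omega>. \<Sum>i\<in>I. F i \<omega>) \<in> adjoin_poly Y"
  by (induction I rule: infinite_finite_induct) (auto intro: adjoin_poly_zero adjoin_poly_add)

lemma adjoin_poly_prod:
  "(\<And>i. i \<in> I \<Longrightarrow> F i \<in> adjoin_poly Y) \<Longrightarrow> (\<lambda>\<omega>. \<Prod>i\<in>I. F i \<omega>) \<in> adjoin_poly Y"
  by (induction I rule: infinite_finite_induct) (auto intro: adjoin_poly_one adjoin_poly_mult)

section \<open>Elimination of one coordinate at a time\<close>

lemma adjoin_reduce:
  assumes p: "\<And>k. p k \<in> adjoin K S Y"
    and rel: "\<And>\<omega>. \<omega> \<in> S \<Longrightarrow> y \<omega> ^ Suc e = (\<Sum>k\<le>e. p k \<omega> * y \<omega> ^ k)"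
    and f: "f \<in> adjoin K S (insert y Y)"
  shows "\<exists>q. (\<forall>k. q k \<in> adjoin K S Y) \<and> (\<forall>\<omega>\<in>S. f \<omega> = (\<Sum>k\<le>e. q k \<omega> * y \<omega> ^ k))"
proof -
  define rep where "rep q g \<longleftrightarrow> (\<forall>k. q k \<in> adjoin K S Y) \<and>
    (\<forall>\<omega>\<in>S. g \<omega> = (\<Sum>k\<le>e. q k \<omega> * y \<omega> ^ k))" for q g
  \<comment> \<open>\<open>V\<close> consists of the polynomials in \<open>y\<close> of degree at
    most \<open>e\<close> over \<open>adjoin K S Y\<close>. It contains \<open>Y\<close> and
    \<open>y\<close>, and \<open>rel\<close> makes it closed under multiplication by
    \<open>y\<close>, hence under products; so it contains everything generated by
    \<open>insert y Y\<close>.\<close>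
  define V where "V = {g. \<exists>q. rep q g}"
  have base: "g \<in> V" if g: "g \<in> adjoin K S Y" for g
  proof -
    have "(if k = 0 then g else (\<lambda>_. 0)) \<in> adjoin K S Y" for k :: nat
      using g adjoin_zero by simp
    moreover have "g \<omega> = (\<Sum>k\<le>e. (if k = 0 then g else (\<lambda>_. 0)) \<omega> * y \<omega> ^ k)" for \<omega>
      by (subst sum.remove[of _ 0]) (auto intro!: sum.neutral)
    ultimately have "rep (\<lambda>k. if k = 0 then g else (\<lambda>_. 0)) g" unfolding rep_def by blast
    then show ?thesis unfolding V_def by blast
  qed
  have plus: "(\<lambda>\<omega>. g \<omega> + h \<omega>) \<in> V" if gh: "g \<in> V" "h \<in> V" for g h
  proof -
    obtain q where "rep q g"
      using gh(1) unfolding V_def by blast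
    moreover obtain r where "rep r h"
      using gh(2) unfolding V_def by blast
    ultimately show ?thesis unfolding V_def rep_def
      by (intro CollectI exI[of _ "\<lambda>k \<omega>. q k \<omega> + r k \<omega>"])
        (auto intro: adjoin.add simp: sum.distrib distrib_right)
  qed
  have scal: "(\<lambda>\<omega>. g \<omega> * h \<omega>) \<in> V" if gh: "g \<in> adjoin K S Y" "h \<in> V" for g h
  proof -
    obtain r where "rep r h"
      using gh(2) unfolding V_def by blast
    then show ?thesis unfolding V_def rep_def using gh(1)
      by (intro CollectI exI[of _ "\<lambda>k \<omega>. g \<omega> * r k \<omega>"])
        (auto intro: adjoin.mult simp: sum_distrib_left mult.assoc)
  qed
  have shift: "(\<lambda>\<omega>. y \<omega> * h \<omega>) \<in> V" if "h \<in> V" for h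
  proof -
    obtain r where r0: "rep r h"
      using \<open>h \<in> V\<close> unfolding V_def by blast
    note r = r0[unfolded rep_def]
    \<comment> \<open>Multiplication by \<open>y\<close> moves each coefficient up one place, with 0
      entering at the bottom. The overflow \<open>r e \<omega> * y \<omega> ^ Suc e\<close> is
      rewritten by \<open>rel\<close>.\<close>
    define q where "q k = (\<lambda>\<omega>. (if k = 0 then (\<lambda>_. 0) else r (k - 1)) \<omega> + r e \<omega> * p k \<omega>)" for k
    have "q k \<in> adjoin K S Y" for k
      unfolding q_def by (intro adjoin.add adjoin.mult) (use r p adjoin_zero in auto)
    moreover have "y \<omega> * h \<omega> = (\<Sum>k\<le>e. q k \<omega> * y \<omega> ^ k)" if "\<omega> \<in> S" for \<omega>
    proof -
      have "y \<omega> * h \<omega> = (\<Sum>k\<le>e. r k \<omega> * y \<omega> ^ Suc k)"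
        using r that by (simp add: sum_distrib_left algebra_simps)
      also have "\<dots> = (\<Sum>k<e. r k \<omega> * y \<omega> ^ Suc k) + r e \<omega> * (\<Sum>k\<le>e. p k \<omega> * y \<omega> ^ k)"
        using rel[OF that] by (simp add: lessThan_Suc_atMost[symmetric])
      also have "(\<Sum>k<e. r k \<omega> * y \<omega> ^ Suc k)
          = (\<Sum>k\<le>e. (if k = 0 then (\<lambda>_. 0) else r (k - 1)) \<omega> * y \<omega> ^ k)"
        by (simp only: lessThan_Suc_atMost[symmetric] sum.lessThan_Suc_shift) simp
      finally show ?thesis
        by (simp add: q_def sum.distrib distrib_right sum_distrib_left mult.assoc)
    qed
    ultimately have "rep q (\<lambda>\<omega>. y \<omega> * h \<omega>)" unfolding rep_def by blast
    then show ?thesis unfolding V_def by blast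
  qed
  have pow: "(\<lambda>\<omega>. y \<omega> ^ k * h \<omega>) \<in> V" if "h \<in> V" for h k
    by (induction k) (use that shift in \<open>auto simp: mult.assoc\<close>)
  have sums: "(\<lambda>\<omega>. \<Sum>i\<in>I. h i \<omega>) \<in> V" if "\<And>i. i \<in> I \<Longrightarrow> h i \<in> V" for h and I :: "nat set"
    using that
    by (induction I rule: infinite_finite_induct) (auto intro: base[OF adjoin_zero] plus)
  have eqv: "g \<in> V" if "h \<in> V" "\<And>\<omega>. \<omega> \<in> S \<Longrightarrow> h \<omega> = g \<omega>" for g h
    using that unfolding V_def rep_def by simp
  from f have "f \<in> V"
  proof (induction rule: adjoin.induct)
    case (gen z)
    have "y \<in> V" using shift[OF base[OF adjoin_one]] by simp
    then show ?case using gen base[OF adjoin.gen] by auto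
  next
    case (mult g h)
    obtain r where r0: "rep r g"
      using mult.IH(1) unfolding V_def by blast
    note r = r0[unfolded rep_def]
    \<comment> \<open>Expanding only the first factor in powers of \<open>y\<close> reduces the
      product to the closure properties \<open>scal\<close>, \<open>pow\<close> and
      \<open>sums\<close>.\<close>
    have "(\<lambda>\<omega>. \<Sum>k\<le>e. r k \<omega> * (y \<omega> ^ k * h \<omega>)) \<in> V"
      by (intro sums scal pow) (use r mult in auto)
    then show ?case
      by (rule eqv) (use r in \<open>simp add: sum_distrib_right mult.assoc\<close>)
  qed (auto intro: base plus eqv adjoin.const)
  then show ?thesis unfolding V_def rep_def by blast
qed

text \<open>Write \<open>f\<close> as a polynomial in \<open>y\<close> of degree at most
  \<open>e\<close> and freeze its coefficients at \<omega>. They are the same throughout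
  \<open>W\<close>, so this polynomial takes the value \<open>f \<omega>\<close> at more than
  \<open>e\<close> points and is constant. Hence \<open>f\<close> agrees on \<open>S\<close> with
  the constant coefficient \<open>q 0\<close>.\<close>

lemma adjoin_descend_step:
  assumes p: "\<And>k. p k \<in> adjoin K S Y"
    and rel: "\<And>\<omega>. \<omega> \<in> S \<Longrightarrow> y \<omega> ^ Suc e = (\<Sum>k\<le>e. p k \<omega> * y \<omega> ^ k)"
    and f: "f \<in> adjoin K S (insert y Y)"
    and fconst: "\<And>w \<omega>. w \<in> S \<Longrightarrow> \<omega> \<in> S \<Longrightarrow> f w = f \<omega>"
    and conj: "\<And>\<omega>. \<omega> \<in> S \<Longrightarrow> \<exists>W\<subseteq>S. card (y ` W) > e \<and> (\<forall>w\<in>W. \<forall>z\<in>Y. z w = z \<omega>)"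
  shows "f \<in> adjoin K S Y"
proof -
  obtain q where q: "\<And>k. q k \<in> adjoin K S Y"
    and fq: "\<And>\<omega>. \<omega> \<in> S \<Longrightarrow> f \<omega> = (\<Sum>k\<le>e. q k \<omega> * y \<omega> ^ k)"
    using adjoin_reduce[OF p rel f] by blast
  have "q 0 \<omega> = f \<omega>" if \<omega>: "\<omega> \<in> S" for \<omega>
  proof -
    obtain W where W: "W \<subseteq> S" "card (y ` W) > e" "\<And>w z. w \<in> W \<Longrightarrow> z \<in> Y \<Longrightarrow> z w = z \<omega>"
      using conj[OF \<omega>] by blast
    define P where "P = (\<Sum>k\<le>e. monom (q k \<omega>) k)"
    have deg: "degree P \<le> e"
      unfolding P_def
      by (intro degree_sum_le) (auto intro: order_trans[OF degree_monom_le])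
    have "P = [:f \<omega>:]"
    proof (rule poly_eqI_degree[of "y ` W"])
      fix x assume "x \<in> y ` W"
      then obtain w where w: "w \<in> W" "x = y w" by blast
      have "q k w = q k \<omega>" for k
        by (rule adjoin_agree[OF q]) (use w W \<omega> in auto)
      then have "poly P x = f w"
        using w W fq[of w] by (auto simp: P_def poly_sum poly_monom)
      then show "poly P x = poly [:f \<omega>:] x" using fconst[of w \<omega>] w W \<omega> by auto
    qed (use W deg in auto)
    then have "coeff P 0 = f \<omega>" by simp
    then show ?thesis by (simp add: P_def coeff_sum)
  qed
  then show ?thesis by (rule adjoin.cong[OF q])
qed

text \<open>Synthetic division by the factors for \<open>x 1\<close>, ..., \<open>x t\<close>: each
  coefficient of the quotient is computed from the dividend and the next higher coefficient of the
  quotient.\<close>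

lemma adjoin_poly_tail:
  assumes "(\<lambda>\<omega>. \<Prod>i=1..n. [:- x i \<omega>, 1:]) \<in> adjoin_poly Y" "t \<le> n"
  shows "(\<lambda>\<omega>. \<Prod>i=Suc t..n. [:- x i \<omega>, 1:]) \<in> adjoin_poly (Y \<union> x ` {1..t})"
  using assms(2)
proof (induction t)
  case 0
  then show ?case using assms(1) by simp
next
  case (Suc t)
  let ?Z = "Y \<union> x ` {1..Suc t}"
  let ?T = "\<lambda>t \<omega>. \<Prod>i=Suc t..n. [:- x i \<omega>, 1:]"
  have T: "?T t \<omega> = [:- x (Suc t) \<omega>, 1:] * ?T (Suc t) \<omega>" for \<omega>
    using Suc.prems by (subst prod.atLeast_Suc_atMost) auto
  have rec: "coeff (?T (Suc t) \<omega>) k =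
      coeff (?T t \<omega>) (Suc k) + x (Suc t) \<omega> * coeff (?T (Suc t) \<omega>) (Suc k)"
    for k \<omega> unfolding T by simp
  have IH: "(\<lambda>\<omega>. coeff (?T t \<omega>) k) \<in> adjoin K S ?Z" for k
    using adjoin_polyD[OF Suc.IH] Suc.prems
    by (auto intro: adjoin_mono[of _ _ _ "Y \<union> x ` {1..t}"])
  have deg: "degree (?T (Suc t) \<omega>) \<le> n" for \<omega>
    by (rule order_trans[OF degree_prod_sum_le]) auto
  \<comment> \<open>Induction downwards on \<open>k\<close>, starting above \<open>n\<close>, where
    the degree bound makes the coefficients vanish.\<close>
  have "(\<lambda>\<omega>. coeff (?T (Suc t) \<omega>) k) \<in> adjoin K S ?Z" for k
  proof (induction "Suc n - k" arbitrary: k)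
    case 0
    then have "coeff (?T (Suc t) \<omega>) k = 0" for \<omega>
      using deg[of \<omega>] by (intro coeff_eq_0) auto
    then show ?case using adjoin_zero by simp
  next
    case (Suc m)
    have "(\<lambda>\<omega>. coeff (?T t \<omega>) (Suc k) + x (Suc t) \<omega> * coeff (?T (Suc t) \<omega>) (Suc k)) \<in> adjoin K S ?Z"
      by (intro adjoin.add adjoin.mult IH Suc.hyps(1) adjoin.gen) (use Suc.hyps in auto)
    then show ?case by (subst rec)
  qed
  then show ?case by (simp add: adjoin_poly_def)
qed

text \<open>The coordinates are removed in the order \<open>x n\<close>, ..., \<open>x 1\<close>.
  Over \<open>Y\<close> and \<open>x 1\<close>, ..., \<open>x t\<close>, the next coordinate is a
  root of the monic product of the factors with index above \<open>t\<close>, and by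
  \<open>swap\<close> it takes each of the \<open>n - t\<close> distinct root values at
  configurations that agree on everything kept.\<close>

lemma adjoin_descend:
  fixes x :: "nat \<Rightarrow> 'w \<Rightarrow> 'c"
  assumes coef: "(\<lambda>\<omega>. \<Prod>i=1..n. [:- x i \<omega>, 1:]) \<in> adjoin_poly Y"
    and inj: "\<And>\<omega>. \<omega> \<in> S \<Longrightarrow> inj_on (\<lambda>i. x i \<omega>) {1..n}"
    and swap: "\<And>\<omega> t i. \<omega> \<in> S \<Longrightarrow> 1 \<le> t \<Longrightarrow> t \<le> i \<Longrightarrow> i \<le> n \<Longrightarrow>
      \<exists>w\<in>S. (\<forall>z\<in>Y. z w = z \<omega>) \<and> (\<forall>l\<in>{1..<t}. x l w = x l \<omega>) \<and> x t w = x i \<omega>"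
    and fconst: "\<And>w \<omega>. w \<in> S \<Longrightarrow> \<omega> \<in> S \<Longrightarrow> f w = f \<omega>"
    and f: "f \<in> adjoin K S (Y \<union> x ` {1..n})"
  shows "f \<in> adjoin K S Y"
proof -
  have "f \<in> adjoin K S (Y \<union> x ` {1..t})" if "t \<le> n" for t
    using that
  proof (induction t rule: inc_induct)
    case base
    then show ?case by (rule f)
  next
    case (step t)
    let ?Z = "Y \<union> x ` {1..t}"
    let ?T = "\<lambda>\<omega>. \<Prod>i=Suc t..n. [:- x i \<omega>, 1:]"
    \<comment> \<open>Chosen so that the tail product \<open>?T\<close> has degree
      \<open>n - t = Suc e\<close>, the exponent that the relation for \<open>x (Suc t)\<close> has
      to reduce.\<close>
    define e where "e = n - Suc t"
    have deg: "degree (?T \<omega>) = Suc e" for \<omega>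
      using step.hyps by (simp add: degree_prod_linear e_def del: prod.cl_ivl_Suc)
    have lead: "coeff (?T \<omega>) (Suc e) = 1" for \<omega>
      using lead_coeff_prod[of "\<lambda>i. [:- x i \<omega>, 1:]" "{Suc t..n}"] by (simp add: deg)
    have T: "?T \<in> adjoin_poly ?Z"
      using adjoin_poly_tail[OF coef] step.hyps by simp
    have ins: "insert (x (Suc t)) ?Z = Y \<union> x ` {1..Suc t}"
      by (auto simp: atLeastAtMostSuc_conv)
    show ?case
    proof (rule adjoin_descend_step)
      show "f \<in> adjoin K S (insert (x (Suc t)) ?Z)" unfolding ins by (rule step.IH)
      show "(\<lambda>\<omega>. - coeff (?T \<omega>) k) \<in> adjoin K S ?Z" for k
        by (intro adjoin_uminus adjoin_polyD T)
      show "x (Suc t) \<omega> ^ Suc e = (\<Sum>k\<le>e. - coeff (?T \<omega>) k * x (Suc t) \<omega> ^ k)" for \<omega>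
      proof -
        have "poly (?T \<omega>) (x (Suc t) \<omega>) = 0"
          using step.hyps by (auto simp: poly_prod)
        then have "(\<Sum>k\<le>Suc e. coeff (?T \<omega>) k * x (Suc t) \<omega> ^ k) = 0"
          by (simp only: poly_altdef deg)
        then show ?thesis by (simp add: lead sum_negf eq_neg_iff_add_eq_0 add.commute)
      qed
      fix \<omega> assume \<omega>: "\<omega> \<in> S"
      \<comment> \<open>The configuration \<open>w i\<close> puts the value
        \<open>x i \<omega>\<close> in place \<open>Suc t\<close>; distinctness of these values
        gives the required \<open>Suc e\<close> points.\<close>
      obtain w where w: "\<And>i. i \<in> {Suc t..n} \<Longrightarrow> w i \<in> S \<and> (\<forall>z\<in>Y. z (w i) = z \<omega>) \<and>
          (\<forall>l\<in>{1..<Suc t}. x l (w i) = x l \<omega>) \<and> x (Suc t) (w i) = x i \<omega>"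
        using swap[OF \<omega>, of "Suc t"] by (metis One_nat_def Suc_le_mono atLeastAtMost_iff le0)
      have "x (Suc t) ` w ` {Suc t..n} = (\<lambda>i. x i \<omega>) ` {Suc t..n}"
        using w by (force simp: image_image)
      moreover have "card ((\<lambda>i. x i \<omega>) ` {Suc t..n}) = Suc e"
        using step.hyps inj_on_subset[OF inj[OF \<omega>], of "{Suc t..n}"]
        by (subst card_image) (auto simp: e_def)
      ultimately have "card (x (Suc t) ` w ` {Suc t..n}) > e" by simp
      then show "\<exists>W\<subseteq>S. card (x (Suc t) ` W) > e \<and> (\<forall>w\<in>W. \<forall>z\<in>?Z. z w = z \<omega>)"
        using w by (intro exI[of _ "w ` {Suc t..n}"]) fastforce
    qed (rule fconst)
  qed
  from this[of 0] show ?thesis by simp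
qed

end

section \<open>Interpolation and bisymmetric functions of the roots\<close>

text \<open>The Lagrange interpolation polynomial for the nodes \<open>x i\<close> and values
  \<open>z i\<close>. In this explicit form it depends polynomially on nodes and values, apart from
  the inverted products of differences.\<close>

definition interp :: "nat \<Rightarrow> (nat \<Rightarrow> 'c::field) \<Rightarrow> (nat \<Rightarrow> 'c) \<Rightarrow> 'c poly" where
  "interp n x z = (\<Sum>i=1..n. smult (z i * inverse (\<Prod>l\<in>{1..n} - {i}. x i - x l))
     (\<Prod>l\<in>{1..n} - {i}. [:- x l, 1:]))"

lemma degree_interp_less:
  assumes "n > 0"
  shows "degree (interp n x z) < n"
proof -
  have "degree (interp n x z) \<le> n - 1"
    unfolding interp_def
    by (intro degree_sum_le order_trans[OF degree_smult_le])
      (auto intro!: order_trans[OF degree_prod_sum_le])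
  then show ?thesis using assms by simp
qed

lemma poly_interp:
  assumes "inj_on x {1..n}" "i \<in> {1..n}"
  shows "poly (interp n x z) (x i) = z i"
proof -
  have "poly (interp n x z) (x i) =
      (\<Sum>k=1..n. z k * inverse (\<Prod>l\<in>{1..n} - {k}. x k - x l) * (\<Prod>l\<in>{1..n} - {k}. x i - x l))"
    by (simp add: interp_def poly_sum poly_prod)
  also have "\<dots> = z i * inverse (\<Prod>l\<in>{1..n} - {i}. x i - x l) * (\<Prod>l\<in>{1..n} - {i}. x i - x l)"
  proof -
    have "(\<Prod>l\<in>{1..n} - {k}. x i - x l) = 0" if "k \<in> {1..n} - {i}" for k
      using that assms(2) by (intro prod_zero) auto
    then have "(\<Sum>k\<in>{1..n} - {i}. z k * inverse (\<Prod>l\<in>{1..n} - {k}. x k - x l) *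
        (\<Prod>l\<in>{1..n} - {k}. x i - x l)) = 0"
      by (intro sum.neutral) simp
    then show ?thesis
      using assms(2) by (subst sum.remove[of _ i]) simp_all
  qed
  also have "(\<Prod>l\<in>{1..n} - {i}. x i - x l) \<noteq> 0"
    using assms by (auto simp: prod_zero_iff dest: inj_onD)
  then have "z i * inverse (\<Prod>l\<in>{1..n} - {i}. x i - x l) * (\<Prod>l\<in>{1..n} - {i}. x i - x l) = z i"
    by (simp add: mult.assoc)
  finally show ?thesis .
qed

lemma interp_unique:
  assumes "inj_on x {1..n}" "degree p < n" "\<And>i. i \<in> {1..n} \<Longrightarrow> poly p (x i) = z i"
  shows "p = interp n x z"
proof (rule poly_eqI_degree)
  show "poly p y = poly (interp n x z) y" if "y \<in> x ` {1..n}" for y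
    using that assms poly_interp[OF assms(1)] by auto
qed (use assms degree_interp_less[of n x z] in \<open>auto simp: card_image\<close>)

text \<open>By uniqueness, only the set of pairs of a node and its value matters, not their
  order.\<close>

lemma interp_permute:
  assumes "inj_on x {1..n}" "\<pi> permutes {1..n}" "n > 0"
  shows "interp n (x \<circ> \<pi>) (z \<circ> \<pi>) = interp n x z"
proof (rule sym, rule interp_unique)
  show "inj_on (x \<circ> \<pi>) {1..n}"
    using assms by (intro comp_inj_on permutes_inj_on) (auto simp: permutes_image)
  show "poly (interp n x z) ((x \<circ> \<pi>) i) = (z \<circ> \<pi>) i" if "i \<in> {1..n}" for i
    using poly_interp[OF assms(1), of "\<pi> i"] that permutes_in_image[OF assms(2)] by simp
qed (rule degree_interp_less[OF assms(3)])

text \<open>A solution of the Vandermonde system is the coefficient sequence of a polynomial of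
  degree below \<open>n\<close> with the prescribed values, so uniqueness of interpolation applies;
  extensionality settles the indices from \<open>n\<close> on.\<close>

lemma vandermonde_sol_eq:
  assumes inj: "inj_on \<alpha> {1..n}" and m: "m < n"
  shows "vandermonde_sol n \<alpha> \<beta> \<tau> m = coeff (interp n \<alpha> (\<beta> \<circ> \<tau>)) m"
proof -
  let ?L = "interp n \<alpha> (\<beta> \<circ> \<tau>)"
  have deg: "degree ?L < n" using degree_interp_less m by (metis gr_zeroI not_less_zero)
  have "vandermonde_sol n \<alpha> \<beta> \<tau> = restrict (coeff ?L) {..<n}"
    unfolding vandermonde_sol_def
  proof (rule the_equality)
    have "poly ?L x = (\<Sum>m<n. coeff ?L m * x ^ m)" for x
      using deg by (subst poly_altdef, intro sum.mono_neutral_left) (auto simp: coeff_eq_0)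
    then show "restrict (coeff ?L) {..<n} \<in> extensional {..<n} \<and>
        (\<forall>i\<in>{1..n}. \<beta> (\<tau> i) = (\<Sum>m<n. restrict (coeff ?L) {..<n} m * \<alpha> i ^ m))"
      using poly_interp[OF inj, of _ "\<beta> \<circ> \<tau>"] by simp
  next
    fix c assume c: "c \<in> extensional {..<n} \<and> (\<forall>i\<in>{1..n}. \<beta> (\<tau> i) = (\<Sum>m<n. c m * \<alpha> i ^ m))"
    define p where "p = (\<Sum>m<n. monom (c m) m)"
    have "degree p \<le> n - 1" unfolding p_def
      by (intro degree_sum_le) (auto intro: order_trans[OF degree_monom_le])
    then have "p = ?L"
      using c m by (intro interp_unique inj) (auto simp: p_def poly_sum poly_monom)
    moreover have "coeff p k = c k" if "k < n" for k
      using that by (simp add: p_def coeff_sum)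
    ultimately show "c = restrict (coeff ?L) {..<n}"
      using c by (intro extensionalityI[of _ "{..<n}"]) auto
  qed
  then show ?thesis using m by simp
qed

text \<open>Both orders of each pair of indices occur, so a permutation introduces no sign: up to
  sign the product is the discriminant.\<close>

lemma prod_differences_permute:
  assumes \<sigma>: "\<sigma> permutes I"
  shows "(\<Prod>i\<in>I. \<Prod>l\<in>I - {i}. (x (\<sigma> i) - x (\<sigma> l) :: 'c::field)) = (\<Prod>i\<in>I. \<Prod>l\<in>I - {i}. x i - x l)"
proof -
  have "(\<Prod>l\<in>I - {i}. x (\<sigma> i) - x (\<sigma> l)) = (\<Prod>l\<in>I - {\<sigma> i}. x (\<sigma> i) - x l)" if "i \<in> I" for i
  proof (rule prod.reindex_bij_betw)
    show "bij_betw \<sigma> (I - {i}) (I - {\<sigma> i})"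
      using bij_betw_DiffI[OF permutes_imp_bij[OF \<sigma>], of "{i}" "{\<sigma> i}"] that permutes_in_image[OF \<sigma>]
      by auto
  qed
  then have "(\<Prod>i\<in>I. \<Prod>l\<in>I - {i}. x (\<sigma> i) - x (\<sigma> l)) = (\<Prod>i\<in>I. \<Prod>l\<in>I - {\<sigma> i}. x (\<sigma> i) - x l)"
    by simp
  also have "\<dots> = (\<Prod>i\<in>I. \<Prod>l\<in>I - {i}. x i - x l)"
    by (rule prod.reindex_bij_betw[OF permutes_imp_bij[OF \<sigma>], of "\<lambda>i. \<Prod>l\<in>I - {i}. x i - x l"])
  finally show ?thesis .
qed

text \<open>A configuration is a pair \<open>(\<sigma>, \<tau>)\<close> that relabels the two lists
  of roots independently. The products of linear factors are the two given polynomials, with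
  coefficients in the field \<open>K\<close>.\<close>

locale root_tuples =
  value_field K "{\<sigma>. \<sigma> permutes {1..n}} \<times> {\<tau>. \<tau> permutes {1..n}}"
  for K :: "'c::field set" and n :: nat +
  fixes \<alpha> \<beta> :: "nat \<Rightarrow> 'c"
  assumes n_pos: "n > 0"
    and inj_\<alpha>: "inj_on \<alpha> {1..n}"
    and inj_\<beta>: "inj_on \<beta> {1..n}"
    and coeff_\<alpha>: "\<And>k. coeff (\<Prod>i=1..n. [:- \<alpha> i, 1:]) k \<in> K"
    and coeff_\<beta>: "\<And>k. coeff (\<Prod>i=1..n. [:- \<beta> i, 1:]) k \<in> K"
begin

abbreviation "P \<equiv> {\<sigma>. \<sigma> permutes {1..n}}"

definition A :: "nat \<Rightarrow> (nat \<Rightarrow> nat) \<times> (nat \<Rightarrow> nat) \<Rightarrow> 'c" where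
  "A i \<omega> = \<alpha> (fst \<omega> i)"

definition B :: "nat \<Rightarrow> (nat \<Rightarrow> nat) \<times> (nat \<Rightarrow> nat) \<Rightarrow> 'c" where
  "B i \<omega> = \<beta> (snd \<omega> i)"

abbreviation "Y \<equiv> A ` {1..n} \<union> B ` {1..n}"
abbreviation "R \<equiv> adjoin K (P \<times> P) Y"

lemma id_P: "id \<in> P" by (simp add: permutes_id)

lemma inj_comp_permutes:
  assumes "inj_on x {1..n}" "\<sigma> \<in> P"
  shows "inj_on (x \<circ> \<sigma>) {1..n}"
  using assms by (intro comp_inj_on permutes_inj_on) (auto simp: permutes_image)

lemma inj_A: "\<omega> \<in> P \<times> P \<Longrightarrow> inj_on (\<lambda>i. A i \<omega>) {1..n}"
  using inj_comp_permutes[OF inj_\<alpha>, of "fst \<omega>"] by (auto simp: A_def comp_def)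

lemma inj_B: "\<omega> \<in> P \<times> P \<Longrightarrow> inj_on (\<lambda>i. B i \<omega>) {1..n}"
  using inj_comp_permutes[OF inj_\<beta>, of "snd \<omega>"] by (auto simp: B_def comp_def)

lemma swap_P:
  assumes "\<sigma> \<in> P" "1 \<le> t" "t \<le> i" "i \<le> n"
  shows "\<sigma> \<circ> transpose t i \<in> P"
  using assms by (auto intro!: permutes_compose permutes_swap_id)

lemma prod_linear_P:
  assumes "\<sigma> \<in> P"
  shows "(\<Prod>i=1..n. [:- x (\<sigma> i), 1:]) = (\<Prod>i=1..n. [:- (x i :: 'c), 1:])"
  using assms prod.reindex_bij_betw[OF permutes_imp_bij, of \<sigma> "{1..n}" "\<lambda>i. [:- x i, 1:]"]
  by simp

text \<open>The coordinates of the second list are eliminated over those of the first, and these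
  then over \<open>K\<close> itself.\<close>

lemma invariant_in_K:
  assumes f: "f \<in> R" and fconst: "\<And>w \<omega>. w \<in> P \<times> P \<Longrightarrow> \<omega> \<in> P \<times> P \<Longrightarrow> f w = f \<omega>"
    and \<omega>: "\<omega> \<in> P \<times> P"
  shows "f \<omega> \<in> K"
proof -
  have "f \<in> adjoin K (P \<times> P) (A ` {1..n})"
  proof (rule adjoin_descend[where n = n and x = B])
    have "(\<lambda>\<omega>. coeff (\<Prod>i=1..n. [:- B i \<omega>, 1:]) k) \<in> adjoin K (P \<times> P) (A ` {1..n})" for k
      by (rule adjoin.cong[OF adjoin.const[OF coeff_\<beta>[of k]]])
        (use prod_linear_P[of _ \<beta>] in \<open>auto simp: B_def\<close>)
    then show "(\<lambda>\<omega>. \<Prod>i=1..n. [:- B i \<omega>, 1:]) \<in> adjoin_poly (A ` {1..n})"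
      unfolding adjoin_poly_def by blast
  next
    fix \<omega> :: "(nat \<Rightarrow> nat) \<times> (nat \<Rightarrow> nat)" and t i
    assume \<omega>: "\<omega> \<in> P \<times> P" and ti: "1 \<le> t" "t \<le> i" "i \<le> n"
    \<comment> \<open>Precomposing \<tau> with the transposition of \<open>t\<close> and
      \<open>i\<close> brings the \<open>i\<close>-th root to place \<open>t\<close>. Since
      \<open>t \<le> i\<close>, the places below \<open>t\<close> stay fixed, and \<sigma> is not
      touched.\<close>
    show "\<exists>w\<in>P \<times> P. (\<forall>z\<in>A ` {1..n}. z w = z \<omega>) \<and> (\<forall>l\<in>{1..<t}. B l w = B l \<omega>) \<and> B t w = B i \<omega>"
      using \<omega> swap_P[OF _ ti, of "snd \<omega>"] ti
      by (intro bexI[of _ "(fst \<omega>, snd \<omega> \<circ> transpose t i)"])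
        (auto simp: A_def B_def transpose_def)
  qed (rule f inj_B fconst | assumption)+
  then have "f \<in> adjoin K (P \<times> P) ({} \<union> A ` {1..n})" by simp
  then have "f \<in> adjoin K (P \<times> P) {}"
  proof (rule adjoin_descend[where n = n and x = A, rotated -1])
    have "(\<lambda>\<omega>. coeff (\<Prod>i=1..n. [:- A i \<omega>, 1:]) k) \<in> adjoin K (P \<times> P) {}" for k
      by (rule adjoin.cong[OF adjoin.const[OF coeff_\<alpha>[of k]]])
        (use prod_linear_P[of _ \<alpha>] in \<open>auto simp: A_def\<close>)
    then show "(\<lambda>\<omega>. \<Prod>i=1..n. [:- A i \<omega>, 1:]) \<in> adjoin_poly {}"
      unfolding adjoin_poly_def by blast
  next
    fix \<omega> :: "(nat \<Rightarrow> nat) \<times> (nat \<Rightarrow> nat)" and t i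
    assume \<omega>: "\<omega> \<in> P \<times> P" and ti: "1 \<le> t" "t \<le> i" "i \<le> n"
    show "\<exists>w\<in>P \<times> P. (\<forall>z\<in>{}. z w = z \<omega>) \<and> (\<forall>l\<in>{1..<t}. A l w = A l \<omega>) \<and> A t w = A i \<omega>"
      using \<omega> swap_P[OF _ ti, of "fst \<omega>"] ti
      by (intro bexI[of _ "(fst \<omega> \<circ> transpose t i, snd \<omega>)"])
        (auto simp: A_def transpose_def)
  qed (rule inj_A fconst | assumption)+
  then show ?thesis using \<omega> by (rule adjoin_empty)
qed

text \<open>The product of these differences over all \<open>i\<close> is a discriminant, hence lies in \<open>K\<close>; this
  makes the factors invertible in \<open>R\<close>.\<close>

lemma inverse_differences:
  assumes x: "\<And>i. i \<in> {1..n} \<Longrightarrow> x i \<in> R" and i: "i \<in> {1..n}"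
    and inj: "\<And>\<omega>. \<omega> \<in> P \<times> P \<Longrightarrow> inj_on (\<lambda>i. x i \<omega>) {1..n}"
    and sym: "\<And>w \<omega>. w \<in> P \<times> P \<Longrightarrow> \<omega> \<in> P \<times> P \<Longrightarrow>
      (\<Prod>i=1..n. \<Prod>l\<in>{1..n} - {i}. x i w - x l w) = (\<Prod>i=1..n. \<Prod>l\<in>{1..n} - {i}. x i \<omega> - x l \<omega>)"
  shows "(\<lambda>\<omega>. inverse (\<Prod>l\<in>{1..n} - {i}. x i \<omega> - x l \<omega>)) \<in> R"
proof -
  define g where "g i \<omega> = (\<Prod>l\<in>{1..n} - {i}. x i \<omega> - x l \<omega>)" for i \<omega>
  define D where "D \<omega> = (\<Prod>i=1..n. g i \<omega>)" for \<omega>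
  have g: "g i \<in> R" if "i \<in> {1..n}" for i
    unfolding g_def using that by (intro adjoin_prod adjoin_diff x) auto
  have g0: "g i \<omega> \<noteq> 0" if "i \<in> {1..n}" "\<omega> \<in> P \<times> P" for i \<omega>
    using inj[OF that(2)] that(1) by (auto simp: g_def dest: inj_onD)
  have "D \<in> R" unfolding D_def by (intro adjoin_prod g)
  moreover have sD: "D w = D \<omega>" if "w \<in> P \<times> P" "\<omega> \<in> P \<times> P" for w \<omega>
    unfolding D_def g_def by (rule sym[OF that])
  ultimately have "D (id, id) \<in> K"
    by (rule invariant_in_K) (use id_P in auto)
  \<comment> \<open>The inverse of \<open>g i\<close> is its cofactor in \<open>D\<close> divided by
    \<open>D\<close>; as \<open>D\<close> is constant, its value at \<open>(id, id)\<close> may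
    stand for it and is inverted inside \<open>K\<close>.\<close>
  then have "(\<lambda>\<omega>. inverse (D (id, id)) * (\<Prod>k\<in>{1..n} - {i}. g k \<omega>)) \<in> R"
    by (intro adjoin.mult adjoin.const inverse_K adjoin_prod g) auto
  then show ?thesis unfolding g_def[symmetric]
  proof (rule adjoin.cong)
    fix \<omega> assume \<omega>: "\<omega> \<in> P \<times> P"
    have "D (id, id) = g i \<omega> * (\<Prod>k\<in>{1..n} - {i}. g k \<omega>)"
      using i \<omega> id_P by (subst sD[of _ \<omega>]) (auto simp: D_def prod.remove[of _ i])
    moreover have "(\<Prod>k\<in>{1..n} - {i}. g k \<omega>) \<noteq> 0" using g0 \<omega> by auto
    ultimately show "inverse (D (id, id)) * (\<Prod>k\<in>{1..n} - {i}. g k \<omega>) = inverse (g i \<omega>)"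
      using g0[OF i \<omega>] by (simp add: field_simps)
  qed
qed

lemma interp_in_adjoin_poly:
  assumes x: "\<And>i. i \<in> {1..n} \<Longrightarrow> x i \<in> R" and z: "\<And>i. i \<in> {1..n} \<Longrightarrow> z i \<in> R"
    and inj: "\<And>\<omega>. \<omega> \<in> P \<times> P \<Longrightarrow> inj_on (\<lambda>i. x i \<omega>) {1..n}"
    and sym: "\<And>w \<omega>. w \<in> P \<times> P \<Longrightarrow> \<omega> \<in> P \<times> P \<Longrightarrow>
      (\<Prod>i=1..n. \<Prod>l\<in>{1..n} - {i}. x i w - x l w) = (\<Prod>i=1..n. \<Prod>l\<in>{1..n} - {i}. x i \<omega> - x l \<omega>)"
  shows "(\<lambda>\<omega>. interp n (\<lambda>i. x i \<omega>) (\<lambda>i. z i \<omega>)) \<in> adjoin_poly Y"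
  unfolding interp_def
proof (intro adjoin_poly_sum adjoin_poly_smult adjoin_poly_prod adjoin.mult[OF z])
  show "(\<lambda>\<omega>. inverse (\<Prod>l\<in>{1..n} - {i}. x i \<omega> - x l \<omega>)) \<in> R" if "i \<in> {1..n}" for i
    by (rule inverse_differences[OF x that inj sym])
  show "(\<lambda>\<omega>. [:- x l \<omega>, 1:]) \<in> adjoin_poly Y" if "l \<in> {1..n} - {i}" for l i
    using that by (intro adjoin_poly_linear x) auto
qed

lemma A_in_R: "i \<in> {1..n} \<Longrightarrow> A i \<in> R"
  by (intro adjoin.gen) auto

lemma B_in_R: "i \<in> {1..n} \<Longrightarrow> B i \<in> R"
  by (intro adjoin.gen) auto

section \<open>Relabellings acting on matchings of the roots\<close>

definition twist :: "(nat \<Rightarrow> nat) \<Rightarrow> (nat \<Rightarrow> nat) \<times> (nat \<Rightarrow> nat) \<Rightarrow> nat \<Rightarrow> nat" where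
  "twist \<pi> \<omega> = snd \<omega> \<circ> \<pi> \<circ> inv_into UNIV (fst \<omega>)"

text \<open>A two-sided translation of the symmetric group, undone by \<open>\<rho> \<mapsto>
  \<tau>\<inverse> \<circ> \<rho> \<circ> \<sigma>\<close>. Sums and products over all permutations
  are therefore the same for every configuration.\<close>

lemma bij_twist:
  assumes "\<omega> \<in> P \<times> P"
  shows "bij_betw (\<lambda>\<pi>. twist \<pi> \<omega>) P P"
proof -
  obtain \<sigma> \<tau> where \<omega>: "\<omega> = (\<sigma>, \<tau>)" "\<sigma> permutes {1..n}" "\<tau> permutes {1..n}"
    using assms by auto
  have "inv_into UNIV \<tau> \<circ> (\<tau> \<circ> \<pi> \<circ> inv_into UNIV \<sigma>) \<circ> \<sigma> = \<pi>"
    "\<tau> \<circ> (inv_into UNIV \<tau> \<circ> \<pi> \<circ> \<sigma>) \<circ> inv_into UNIV \<sigma> = \<pi>" for \<pi>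
    using permutes_inverses[OF \<omega>(2)] permutes_inverses[OF \<omega>(3)] by (auto simp: fun_eq_iff)
  then show ?thesis
    using \<omega>
    by (intro bij_betw_byWitness[where f' = "\<lambda>\<rho>. inv_into UNIV \<tau> \<circ> \<rho> \<circ> \<sigma>"])
      (auto simp: twist_def intro!: permutes_compose permutes_inv)
qed

text \<open>A family \<open>u\<close> is given for one fixed enumeration of the roots. Twisting its
  index turns each member into a function of the configuration, and this function has to be
  generated by the coordinates.\<close>

definition admissible :: "((nat \<Rightarrow> nat) \<Rightarrow> 'c) \<Rightarrow> bool" where
  "admissible u \<longleftrightarrow> (\<forall>\<pi>\<in>P. (\<lambda>\<omega>. u (twist \<pi> \<omega>)) \<in> R)"

lemma admissible_one: "admissible (\<lambda>_. 1)"
  unfolding admissible_def by (intro ballI adjoin_one)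

text \<open>Interpolating through the relabelled data sends \<open>\<alpha> (\<sigma> i)\<close> to
  \<open>\<beta> (\<tau> (\<pi> i))\<close>. Reordering the nodes by \<sigma> shows that this is the
  interpolant of \<open>\<beta> \<circ> twist \<pi> \<omega>\<close> at the original nodes.\<close>

lemma admissible_interp_forward: "admissible (\<lambda>\<rho>. coeff (interp n \<alpha> (\<beta> \<circ> \<rho>)) m)"
  unfolding admissible_def
proof
  fix \<pi> assume \<pi>: "\<pi> \<in> P"
  have "(\<lambda>\<omega>. interp n (\<lambda>i. A i \<omega>) (\<lambda>i. B (\<pi> i) \<omega>)) \<in> adjoin_poly Y"
  proof (rule interp_in_adjoin_poly)
    show "(\<Prod>i=1..n. \<Prod>l\<in>{1..n} - {i}. A i w - A l w) =
        (\<Prod>i=1..n. \<Prod>l\<in>{1..n} - {i}. A i \<omega> - A l \<omega>)"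
      if "w \<in> P \<times> P" "\<omega> \<in> P \<times> P" for w \<omega>
      using that by (auto simp: A_def prod_differences_permute[where x = \<alpha>])
    show "B (\<pi> i) \<in> R" if "i \<in> {1..n}" for i
      using \<pi> that permutes_in_image[of \<pi> "{1..n}"] by (intro B_in_R) auto
  qed (rule A_in_R inj_A | assumption)+
  then show "(\<lambda>\<omega>. coeff (interp n \<alpha> (\<beta> \<circ> twist \<pi> \<omega>)) m) \<in> R"
  proof (intro adjoin.cong[OF adjoin_polyD[where k = m]])
    fix \<omega> assume \<omega>: "\<omega> \<in> P \<times> P"
    then have "interp n (\<lambda>i. A i \<omega>) (\<lambda>i. B (\<pi> i) \<omega>)
        = interp n (\<alpha> \<circ> fst \<omega>) (\<beta> \<circ> twist \<pi> \<omega> \<circ> fst \<omega>)"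
      using permutes_inverses(2)[of "fst \<omega>" "{1..n}"]
      by (auto simp: A_def B_def twist_def comp_def)
    also have "\<dots> = interp n \<alpha> (\<beta> \<circ> twist \<pi> \<omega>)"
      using \<omega> by (intro interp_permute inj_\<alpha> n_pos) auto
    finally show "coeff (interp n (\<lambda>i. A i \<omega>) (\<lambda>i. B (\<pi> i) \<omega>)) m
        = coeff (interp n \<alpha> (\<beta> \<circ> twist \<pi> \<omega>)) m" by simp
  qed
qed

text \<open>The same argument with nodes and values exchanged; the nodes are now permuted by both
  \<pi> and \<tau>, and neither changes their discriminant.\<close>

lemma admissible_interp_backward: "admissible (\<lambda>\<rho>. coeff (interp n (\<beta> \<circ> \<rho>) \<alpha>) m)"
  unfolding admissible_def
proof
  fix \<pi> assume \<pi>: "\<pi> \<in> P"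
  have "inj_on (\<lambda>i. B (\<pi> i) \<omega>) {1..n}" if "\<omega> \<in> P \<times> P" for \<omega>
    using inj_comp_permutes[OF inj_B[OF that] \<pi>] by (simp add: comp_def)
  moreover have "(\<Prod>i=1..n. \<Prod>l\<in>{1..n} - {i}. B (\<pi> i) \<omega> - B (\<pi> l) \<omega>)
      = (\<Prod>i=1..n. \<Prod>l\<in>{1..n} - {i}. \<beta> i - \<beta> l)" if "\<omega> \<in> P \<times> P" for \<omega>
    using prod_differences_permute[of \<pi> "{1..n}" "\<lambda>i. B i \<omega>"] \<pi> that
    by (auto simp: B_def prod_differences_permute[where x = \<beta>])
  ultimately have "(\<lambda>\<omega>. interp n (\<lambda>i. B (\<pi> i) \<omega>) (\<lambda>i. A i \<omega>)) \<in> adjoin_poly Y"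
    using \<pi> permutes_in_image[of \<pi> "{1..n}"]
    by (intro interp_in_adjoin_poly A_in_R B_in_R) auto
  then show "(\<lambda>\<omega>. coeff (interp n (\<beta> \<circ> twist \<pi> \<omega>) \<alpha>) m) \<in> R"
  proof (intro adjoin.cong[OF adjoin_polyD[where k = m]])
    fix \<omega> assume \<omega>: "\<omega> \<in> P \<times> P"
    then have "interp n (\<lambda>i. B (\<pi> i) \<omega>) (\<lambda>i. A i \<omega>)
        = interp n (\<beta> \<circ> twist \<pi> \<omega> \<circ> fst \<omega>) (\<alpha> \<circ> fst \<omega>)"
      using permutes_inverses(2)[of "fst \<omega>" "{1..n}"]
      by (auto simp: A_def B_def twist_def comp_def)
    also have "\<dots> = interp n (\<beta> \<circ> twist \<pi> \<omega>) \<alpha>"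
      using \<omega> \<pi> bij_betwE[OF bij_twist[OF \<omega>]]
      by (intro interp_permute inj_comp_permutes inj_\<beta> n_pos) auto
    finally show "coeff (interp n (\<lambda>i. B (\<pi> i) \<omega>) (\<lambda>i. A i \<omega>)) m
        = coeff (interp n (\<beta> \<circ> twist \<pi> \<omega>) \<alpha>) m" by simp
  qed
qed

lemma coeff_invariant_in_K:
  assumes "F \<in> adjoin_poly Y" "\<And>\<omega>. \<omega> \<in> P \<times> P \<Longrightarrow> F \<omega> = p"
  shows "coeff p k \<in> K"
  using invariant_in_K[OF adjoin_polyD[OF assms(1)], of k "(id, id)"] assms(2) id_P by auto

section \<open>Resolvents and the descent of simple roots\<close>

lemma coeff_resolvent_in_K:
  assumes u: "admissible u"
  shows "coeff (\<Prod>\<rho>\<in>P. [:- u \<rho>, 1:]) k \<in> K"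
proof (rule coeff_invariant_in_K)
  show "(\<lambda>\<omega>. \<Prod>\<pi>\<in>P. [:- u (twist \<pi> \<omega>), 1:]) \<in> adjoin_poly Y"
    using u by (intro adjoin_poly_prod adjoin_poly_linear) (auto simp: admissible_def)
  \<comment> \<open>Relabelling the roots only permutes the linear factors.\<close>
  show "(\<Prod>\<pi>\<in>P. [:- u (twist \<pi> \<omega>), 1:]) = (\<Prod>\<rho>\<in>P. [:- u \<rho>, 1:])" if "\<omega> \<in> P \<times> P" for \<omega>
    by (rule prod.reindex_bij_betw[OF bij_twist[OF that], of "\<lambda>\<rho>. [:- u \<rho>, 1:]"])
qed

text \<open>Lagrange's resolvent; for constant weight 1 it is the derivative of the product of the
  factors \<open>[:- u \<rho>, 1:]\<close>.\<close>

definition cofactor_sum :: "((nat \<Rightarrow> nat) \<Rightarrow> 'c) \<Rightarrow> ((nat \<Rightarrow> nat) \<Rightarrow> 'c) \<Rightarrow> 'c poly" where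
  "cofactor_sum u w = (\<Sum>\<rho>\<in>P. smult (w \<rho>) (\<Prod>\<rho>'\<in>P - {\<rho>}. [:- u \<rho>', 1:]))"

lemma coeff_cofactor_sum_in_K:
  assumes u: "admissible u" and w: "admissible w"
  shows "coeff (cofactor_sum u w) k \<in> K"
proof (rule coeff_invariant_in_K)
  let ?G = "\<lambda>\<omega>. \<Sum>\<pi>\<in>P. smult (w (twist \<pi> \<omega>)) (\<Prod>\<pi>'\<in>P - {\<pi>}. [:- u (twist \<pi>' \<omega>), 1:])"
  show "?G \<in> adjoin_poly Y"
    using u w
    by (intro adjoin_poly_sum adjoin_poly_smult adjoin_poly_prod adjoin_poly_linear)
      (auto simp: admissible_def)
  fix \<omega> assume \<omega>: "\<omega> \<in> P \<times> P"
  note bij = bij_twist[OF \<omega>]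
  have "(\<Prod>\<pi>'\<in>P - {\<pi>}. [:- u (twist \<pi>' \<omega>), 1:]) =
      (\<Prod>\<rho>'\<in>P - {twist \<pi> \<omega>}. [:- u \<rho>', 1:])"
    if "\<pi> \<in> P" for \<pi>
  proof (rule prod.reindex_bij_betw[where h = "\<lambda>\<pi>. twist \<pi> \<omega>"
        and g = "\<lambda>\<rho>. [:- u \<rho>, 1:]"])
    show "bij_betw (\<lambda>\<pi>. twist \<pi> \<omega>) (P - {\<pi>}) (P - {twist \<pi> \<omega>})"
      using that bij_betwE[OF bij] by (intro bij_betw_DiffI[OF bij]) auto
  qed
  then have "?G \<omega> = (\<Sum>\<pi>\<in>P. smult (w (twist \<pi> \<omega>)) (\<Prod>\<rho>'\<in>P - {twist \<pi> \<omega>}. [:- u \<rho>', 1:]))"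
    by simp
  also have "\<dots> = cofactor_sum u w"
    unfolding cofactor_sum_def 
    by (rule sum.reindex_bij_betw[OF bij,
          of "\<lambda>\<rho>. smult (w \<rho>) (\<Prod>\<rho>'\<in>P - {\<rho>}. [:- u \<rho>', 1:])"])
  finally show "?G \<omega> = cofactor_sum u w" .
qed

lemma finite_P: "finite P"
  by (rule finite_permutations) simp

lemma poly_cofactor_sum:
  assumes "\<rho> \<in> P"
  shows "poly (cofactor_sum u w) (u \<rho>) = w \<rho> * (\<Prod>\<rho>'\<in>P - {\<rho>}. u \<rho> - u \<rho>')"
proof -
  have "poly (cofactor_sum u w) (u \<rho>) = (\<Sum>\<kappa>\<in>P. w \<kappa> * (\<Prod>\<rho>'\<in>P - {\<kappa>}. u \<rho> - u \<rho>'))"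
    by (simp add: cofactor_sum_def poly_sum poly_prod)
  also have "\<dots> = w \<rho> * (\<Prod>\<rho>'\<in>P - {\<rho>}. u \<rho> - u \<rho>') +
      (\<Sum>\<kappa>\<in>P - {\<rho>}. w \<kappa> * (\<Prod>\<rho>'\<in>P - {\<kappa>}. u \<rho> - u \<rho>'))"
    by (rule sum.remove[OF finite_P assms])
  \<comment> \<open>Every cofactor other than that of \<rho> retains the factor of \<rho>, which
    vanishes at \<open>u \<rho>\<close>.\<close>
  also have "(\<Sum>\<kappa>\<in>P - {\<rho>}. w \<kappa> * (\<Prod>\<rho>'\<in>P - {\<kappa>}. u \<rho> - u \<rho>')) = 0"
  proof (intro sum.neutral ballI)
    fix \<kappa> assume "\<kappa> \<in> P - {\<rho>}"
    then have "(\<Prod>\<rho>'\<in>P - {\<kappa>}. u \<rho> - u \<rho>') = 0"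
      using assms finite_P by (intro prod_zero) auto
    then show "w \<kappa> * (\<Prod>\<rho>'\<in>P - {\<kappa>}. u \<rho> - u \<rho>') = 0" by simp
  qed
  finally show ?thesis by simp
qed

lemma simple_value_determines:
  assumes u: "admissible u" and w: "admissible w" and \<rho>: "\<rho> \<in> P" and uK: "u \<rho> \<in> K"
    and simple: "\<And>\<rho>'. \<rho>' \<in> P - {\<rho>} \<Longrightarrow> u \<rho>' \<noteq> u \<rho>"
  shows "w \<rho> \<in> K"
proof -
  have D0: "(\<Prod>\<rho>'\<in>P - {\<rho>}. u \<rho> - u \<rho>') \<noteq> 0"
    using simple finite_P by (force simp: prod_zero_iff)
  \<comment> \<open>Numerator and denominator share the product of the differences
    \<open>u \<rho> - u \<rho>'\<close>, which is nonzero by simplicity; cancelling it leaves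
    \<open>w \<rho>\<close>.\<close>
  have "poly (cofactor_sum u w) (u \<rho>) * inverse (poly (cofactor_sum u (\<lambda>_. 1)) (u \<rho>)) \<in> K"
    by (intro mult_K inverse_K poly_K coeff_cofactor_sum_in_K u w admissible_one uK)
  then show ?thesis using D0 by (simp add: poly_cofactor_sum[OF \<rho>] mult.assoc)
qed

end

section \<open>Homomorphisms between quotients of the polynomial ring\<close>

abbreviation poly_ring :: "'m::field poly ring" where "poly_ring \<equiv> ring_of_type_algebra"

abbreviation multiples :: "'m::field poly \<Rightarrow> 'm poly set" where
  "multiples p \<equiv> PIdl\<^bsub>poly_ring\<^esub> p"

abbreviation residue :: "'m::field poly \<Rightarrow> 'm poly \<Rightarrow> 'm poly set" where
  "residue p g \<equiv> multiples p +>\<^bsub>poly_ring\<^esub> g"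

lemma residue_eq: "residue p g = {f. p dvd f - g}"
proof -
  have "residue p g = (\<lambda>x. x * p + g) ` UNIV"
    by (auto simp: a_r_coset_def' cgenideal_def ring_of_type_algebra_def)
  also have "\<dots> = {f. p dvd f - g}"
    by (auto simp: dvd_def algebra_simps image_iff)
  finally show ?thesis .
qed

lemma residue_eq_iff: "residue p f = residue p g \<longleftrightarrow> p dvd f - g"
proof
  assume "residue p f = residue p g"
  then have "f \<in> residue p g" by (auto simp: residue_eq)
  then show "p dvd f - g" by (simp add: residue_eq)
next
  assume fg: "p dvd f - g"
  have "p dvd h - f \<longleftrightarrow> p dvd h - g" for h
    using dvd_add_left_iff[OF fg, of "h - f"] by simp
  then show "residue p f = residue p g" by (simp add: residue_eq)
qed

lemma poly_ring_simps [simp]: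
  "carrier poly_ring = UNIV" "x \<otimes>\<^bsub>poly_ring\<^esub> y = x * y" "x \<oplus>\<^bsub>poly_ring\<^esub> y = x + y"
  "\<one>\<^bsub>poly_ring\<^esub> = 1" "\<zero>\<^bsub>poly_ring\<^esub> = 0"
  by (simp_all add: ring_of_type_algebra_def)

lemma ideal_multiples: "ideal (multiples p) poly_ring"
  by (rule cring.cgenideal_ideal[OF cring_from_type_algebra]) simp

lemma poly_quot_simps:
  "carrier (poly_quot p) = range (residue p)"
  "residue p f \<otimes>\<^bsub>poly_quot p\<^esub> residue p g = residue p (f * g)"
  "residue p f \<oplus>\<^bsub>poly_quot p\<^esub> residue p g = residue p (f + g)"
  "\<one>\<^bsub>poly_quot p\<^esub> = residue p 1"
  "c \<odot>\<^bsub>poly_quot p\<^esub> residue p g = residue p ([:c:] * g)"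
  using ring_hom_mult[OF ideal.rcos_ring_hom[OF ideal_multiples[of p]], of f g]
    ring_hom_add[OF ideal.rcos_ring_hom[OF ideal_multiples[of p]], of f g]
    ring_hom_mult[OF ideal.rcos_ring_hom[OF ideal_multiples[of p]], of "[:c:]" g]
    ring_hom_one[OF ideal.rcos_ring_hom[OF ideal_multiples[of p]]]
  by (auto simp: poly_quot_def Let_def ring.extend_def module.fields_def FactRing_def
      A_RCOSETS_def')

section \<open>Quotient isomorphisms as substitutions\<close>

lemma dvd_pcompose_diff:
  fixes f g h :: "'m::field poly"
  shows "f - g dvd pcompose h f - pcompose h g"
proof (induction h)
  case (pCons a h)
  have "pcompose (pCons a h) f - pcompose (pCons a h) g
      = f * (pcompose h f - pcompose h g) + (f - g) * pcompose h g"
    by (simp add: pcompose_pCons algebra_simps)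
  then show ?case using pCons by simp
qed simp

lemma dvd_pcompose: "p dvd q \<Longrightarrow> pcompose p r dvd pcompose q (r :: 'm::field poly)"
  by (auto simp: dvd_def pcompose_mult)

text \<open>Substituting \<open>d\<close> leads from \<open>M[X]/(p)\<close> to
  \<open>M[X]/(q)\<close>, and substituting \<open>c\<close> leads back; the last two hypotheses say
  that both composites fix the class of \<open>X\<close>.\<close>

lemma algebra_isomorphic_poly_quotI:
  fixes p q c d :: "'m::field poly"
  assumes pd: "q dvd pcompose p d" and qc: "p dvd pcompose q c"
    and cd: "q dvd pcompose c d - [:0, 1:]" and dc: "p dvd pcompose d c - [:0, 1:]"
  shows "algebra_isomorphic (ring_of_type_algebra :: 'm ring) (poly_quot p) (poly_quot q)"
proof -
  \<comment> \<open>One direction makes the substitution well defined on classes. The other, its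
    injectivity, follows by substituting \<open>c\<close> afterwards, which returns \<open>g\<close>
    modulo \<open>p\<close>.\<close>
  have kernel: "q dvd pcompose g d \<longleftrightarrow> p dvd g" for g
  proof
    assume "p dvd g"
    then show "q dvd pcompose g d" using dvd_pcompose[of p g d] pd dvd_trans by blast
  next
    assume "q dvd pcompose g d"
    then have "p dvd pcompose (pcompose g d) c" using dvd_pcompose qc dvd_trans by blast
    moreover have "p dvd pcompose g (pcompose d c) - pcompose g [:0, 1:]"
      using dc dvd_pcompose_diff dvd_trans by blast
    ultimately show "p dvd g" by (simp add: pcompose_assoc dvd_diff_right_iff)
  qed
  have surj: "q dvd pcompose (pcompose g c) d - g" for g
    using dvd_trans[OF cd dvd_pcompose_diff[of _ _ g]] by (simp add: pcompose_assoc)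
  \<comment> \<open>A class is a set of polynomials, so a representative is chosen;
    \<open>kernel\<close> shows that the choice does not affect the value.\<close>
  define H where "H Z = residue q (pcompose (SOME g. Z = residue p g) d)" for Z
  have H: "H (residue p g) = residue q (pcompose g d)" for g
  proof -
    define g' where "g' = (SOME g'. residue p g = residue p g')"
    have "residue p g = residue p g'" unfolding g'_def by (rule someI) simp
    then have "q dvd pcompose (g' - g) d"
      by (subst kernel) (metis residue_eq_iff)
    then have "residue q (pcompose g' d) = residue q (pcompose g d)"
      by (simp add: residue_eq_iff pcompose_diff)
    then show ?thesis by (simp only: H_def g'_def)
  qed
  have "H \<in> ring_hom (poly_quot p) (poly_quot q)"
    by (rule ring_hom_memI)
      (auto simp: poly_quot_simps H pcompose_mult pcompose_add pcompose_1)
  moreover have "inj_on H (carrier (poly_quot p))"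
  proof (rule inj_onI)
    fix Z W assume "Z \<in> carrier (poly_quot p)" "W \<in> carrier (poly_quot p)" and eq: "H Z = H W"
    then obtain f g where "Z = residue p f" "W = residue p g"
      unfolding poly_quot_simps by blast
    with eq show "Z = W" by (simp only: H residue_eq_iff kernel pcompose_diff[symmetric])
  qed
  moreover have "H ` carrier (poly_quot p) = carrier (poly_quot q)"
  proof -
    have "residue q g \<in> H ` range (residue p)" for g
      using surj[of g] by (intro image_eqI[of _ _ "residue p (pcompose g c)"])
        (auto simp: H residue_eq_iff dvd_diff_commute)
    then show ?thesis by (auto simp: poly_quot_simps H)
  qed
  ultimately have "H \<in> ring_iso (poly_quot p) (poly_quot q)"
    by (auto simp: ring_iso_def bij_betw_def)
  moreover have "\<forall>a\<in>carrier (ring_of_type_algebra :: 'm ring). \<forall>Z\<in>carrier (poly_quot p).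
      H (a \<odot>\<^bsub>poly_quot p\<^esub> Z) = a \<odot>\<^bsub>poly_quot q\<^esub> H Z"
    by (auto simp: poly_quot_simps H pcompose_smult simp del: mult_pCons_left)
      (simp_all add: poly_quot_simps H pcompose_smult)
  ultimately show ?thesis unfolding algebra_isomorphic_def by blast
qed

text \<open>Take for \<open>d\<close> a representative of the image of the class of
  \<open>X\<close>. Compatibility with scalars forces the map to be substitution of
  \<open>d\<close>; then the zero class of \<open>p\<close> gives the first divisibility, and
  surjectivity provides \<open>c\<close>.\<close>

lemma algebra_isomorphic_poly_quotE:
  fixes p q :: "'m::field poly"
  assumes "algebra_isomorphic (ring_of_type_algebra :: 'm ring) (poly_quot p) (poly_quot q)"
  obtains c d where "q dvd pcompose p d" "q dvd pcompose c d - [:0, 1:]"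
proof -
  obtain H where H: "H \<in> ring_iso (poly_quot p) (poly_quot q)"
    and smult: "\<And>a Z. Z \<in> carrier (poly_quot p) \<Longrightarrow> H (a \<odot>\<^bsub>poly_quot p\<^esub> Z) = a \<odot>\<^bsub>poly_quot q\<^esub> H Z"
    using assms by (auto simp: algebra_isomorphic_def ring_of_type_algebra_def)
  have hom: "H \<in> ring_hom (poly_quot p) (poly_quot q)"
    and bij: "bij_betw H (carrier (poly_quot p)) (carrier (poly_quot q))"
    using H by (auto simp: ring_iso_def)
  have in_carrier: "residue p g \<in> carrier (poly_quot p)" for p g :: "'m poly"
    by (simp add: poly_quot_simps)
  have "H (residue p [:0, 1:]) \<in> carrier (poly_quot q)"
    by (rule ring_hom_closed[OF hom in_carrier])
  then obtain d where d: "H (residue p [:0, 1:]) = residue q d" by (auto simp: poly_quot_simps)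
  \<comment> \<open>A constant class is a scalar multiple of the class of 1, which is
    preserved.\<close>
  have const: "H (residue p [:a:]) = residue q [:a:]" for a
    using smult[OF in_carrier[of p 1], of a] ring_hom_one[OF hom] by (simp add: poly_quot_simps)
  have Hd: "H (residue p g) = residue q (pcompose g d)" for g
  proof (induction g)
    case 0
    then show ?case using const[of 0] by simp
  next
    case (pCons a g)
    have split: "pCons a g = [:a:] + [:0, 1:] * g" by simp
    have "H (residue p (pCons a g)) = H (residue p [:a:]) \<oplus>\<^bsub>poly_quot q\<^esub>
        (H (residue p [:0, 1:]) \<otimes>\<^bsub>poly_quot q\<^esub> H (residue p g))"
      unfolding split poly_quot_simps(2,3)[symmetric]
      by (subst ring_hom_add[OF hom], simp_all add: ring_hom_mult[OF hom] in_carrier)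
        (simp add: poly_quot_simps)
    then show ?case by (simp add: const d pCons poly_quot_simps pcompose_pCons)
  qed
  have "residue q (pcompose p d) = H (residue p p)" by (simp add: Hd)
  also have "residue p p = residue p 0" by (simp add: residue_eq_iff)
  also have "H \<dots> = residue q 0" by (simp add: Hd)
  finally have 1: "q dvd pcompose p d" by (simp add: residue_eq_iff)
  have "residue q [:0, 1:] \<in> H ` carrier (poly_quot p)"
    using bij in_carrier by (simp add: bij_betw_def)
  then obtain c where "residue q [:0, 1:] = residue q (pcompose c d)"
    by (auto simp: poly_quot_simps Hd)
  then have "q dvd pcompose c d - [:0, 1:]"
    by (metis residue_eq_iff)
  with 1 show ?thesis by (rule that)
qed

section \<open>Roots in the algebraic closure\<close>

lemma map_poly_to_ac_add:
  "map_poly to_ac (p + q) = map_poly to_ac p + map_poly to_ac (q :: 'm::field poly)"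
  by (rule poly_eqI) (simp add: coeff_map_poly)

lemma map_poly_to_ac_mult:
  "map_poly to_ac (p * q) = map_poly to_ac p * map_poly to_ac (q :: 'm::field poly)"
  by (rule poly_eqI) (simp add: coeff_map_poly coeff_mult to_ac_sum)

lemma poly_map_poly_to_ac: "poly (map_poly to_ac p) (to_ac x) = to_ac (poly p (x :: 'm::field))"
  by (induction p) (simp_all add: map_poly_pCons)

lemma map_poly_to_ac_pcompose:
  "map_poly to_ac (pcompose p q) = pcompose (map_poly to_ac p) (map_poly to_ac (q :: 'm::field poly))"
  by (induction p)
    (simp_all add: map_poly_pCons pcompose_pCons map_poly_to_ac_add map_poly_to_ac_mult)

lemma map_poly_to_ac_inj: "map_poly to_ac p = map_poly to_ac q \<longleftrightarrow> p = (q :: 'm::field poly)"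
  by (auto simp: poly_eq_iff coeff_map_poly)

lemma map_poly_to_ac_surj:
  assumes "\<And>k. coeff p k \<in> range (to_ac :: 'm::field \<Rightarrow> 'm alg_closure)"
  obtains q :: "'m::field poly" where "map_poly to_ac q = p"
proof
  show "map_poly to_ac (map_poly of_ac p) = p"
    using assms by (intro poly_eqI) (simp add: coeff_map_poly to_ac_of_ac)
qed

text \<open>Two indices with the same value would give a root of order at least 2.\<close>

lemma rsquarefree_prod_linear_inj:
  fixes u :: "'i \<Rightarrow> 'c::idom"
  assumes "finite I" "rsquarefree (\<Prod>i\<in>I. [:- u i, 1:])"
  shows "inj_on u I"
proof (rule inj_onI, rule ccontr)
  fix i l assume il: "i \<in> I" "l \<in> I" "u i = u l" "i \<noteq> l"
  let ?q = "\<Prod>l\<in>I - {i}. [:- u l, 1:]"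
  have p: "(\<Prod>i\<in>I. [:- u i, 1:]) = [:- u i, 1:] * ?q"
    by (rule prod.remove[OF assms(1) il(1)])
  have p0: "[:- u i, 1:] * ?q \<noteq> 0" using assms unfolding p by (simp add: rsquarefree_def)
  have "order (u i) ?q \<noteq> 0"
  proof -
    have "poly ?q (u i) = 0"
      using il assms(1) by (auto simp: poly_prod)
    then show ?thesis using p0 order_root[of ?q "u i"] by auto
  qed
  moreover have "order (u i) [:- u i, 1:] \<noteq> 0"
    using order_root[of "[:- u i, 1:]" "u i"] by simp
  ultimately have "order (u i) ([:- u i, 1:] * ?q) \<ge> 2"
    unfolding order_mult[OF p0] by linarith
  moreover have "order (u i) ([:- u i, 1:] * ?q) \<in> {0, 1}"
    using assms(2) unfolding p rsquarefree_def by blast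
  ultimately show False by auto
qed

section \<open>Divisibility tested on the roots\<close>

lemma roots_enum_inj: "roots_enum n p \<alpha> \<Longrightarrow> no_multiple_root p \<Longrightarrow> inj_on \<alpha> {1..n}"
  by (rule rsquarefree_prod_linear_inj) (simp_all add: roots_enum_def no_multiple_root_def)

lemma roots_enum_poly:
  "roots_enum n p \<alpha> \<Longrightarrow> poly (map_poly to_ac p) x = 0 \<longleftrightarrow> (\<exists>i\<in>{1..n}. x = \<alpha> i)"
  by (auto simp: roots_enum_def poly_prod)

lemma roots_enum_poly_mod:
  assumes "roots_enum n p \<alpha>" "i \<in> {1..n}"
  shows "poly (map_poly to_ac (g mod p)) (\<alpha> i) = poly (map_poly to_ac g) (\<alpha> i)"
proof -
  have "map_poly to_ac g = map_poly to_ac (g div p) * map_poly to_ac p + map_poly to_ac (g mod p)"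
    by (simp flip: map_poly_to_ac_add map_poly_to_ac_mult)
  moreover have "poly (map_poly to_ac p) (\<alpha> i) = 0"
    using roots_enum_poly[OF assms(1)] assms(2) by blast
  ultimately show ?thesis by simp
qed

lemma roots_enum_degree: "roots_enum n (p :: 'm::field poly) \<alpha> \<Longrightarrow> degree p = n"
proof -
  assume "roots_enum n p \<alpha>"
  then have "degree (map_poly to_ac p) = n"
    by (simp add: roots_enum_def degree_prod_linear)
  then show ?thesis by (simp add: degree_map_poly)
qed

text \<open>The remainder modulo \<open>p\<close> has degree below \<open>n\<close> but vanishes at
  \<open>n\<close> distinct points of the closure, so it is zero there and, by injectivity of
  \<open>to_ac\<close>, over the base field.\<close>

lemma roots_enum_dvd:
  fixes p g :: "'m::field poly"
  assumes en: "roots_enum n p \<alpha>" and n: "n > 0" and inj: "inj_on \<alpha> {1..n}"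
    and van: "\<And>i. i \<in> {1..n} \<Longrightarrow> poly (map_poly to_ac g) (\<alpha> i) = 0"
  shows "p dvd g"
proof -
  have p0: "p \<noteq> 0" and deg: "degree p = n" using roots_enum_degree[OF en] n by auto
  let ?r = "g mod p"
  have "map_poly to_ac ?r = 0"
  proof (rule poly_eqI_degree)
    fix x assume "x \<in> \<alpha> ` {1..n}"
    then obtain i where i: "i \<in> {1..n}" "x = \<alpha> i" by blast
    then show "poly (map_poly to_ac ?r) x = poly 0 x"
      using van roots_enum_poly_mod[OF en] by simp
  next
    show "card (\<alpha> ` {1..n}) > degree (map_poly to_ac ?r)"
      using degree_mod_less'[OF p0, of g] n deg card_image[OF inj]
      by (cases "?r = 0") (auto simp: degree_map_poly)
  qed (use n card_image[OF inj] in auto)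
  then show ?thesis using map_poly_to_ac_inj[of ?r 0] by (simp add: dvd_eq_mod_eq_0)
qed

text \<open>All four divisibilities are checked on the roots, which \<open>c\<close> and
  \<open>d\<close> exchange along the matching of \<open>\<alpha> i\<close> with
  \<open>\<beta> (\<rho> i)\<close>; every root of \<open>q\<close> occurs since \<rho> is
  onto.\<close>

lemma interpolants_imp_isomorphic:
  fixes p q :: "'m::field poly"
  assumes n: "n > 0" and p: "roots_enum n p \<alpha>" "inj_on \<alpha> {1..n}"
    and q: "roots_enum n q \<beta>" "inj_on \<beta> {1..n}"
    and \<rho>: "\<rho> permutes {1..n}"
    and c: "\<And>i. i \<in> {1..n} \<Longrightarrow> poly (map_poly to_ac c) (\<alpha> i) = \<beta> (\<rho> i)"
    and d: "\<And>i. i \<in> {1..n} \<Longrightarrow> poly (map_poly to_ac d) (\<beta> (\<rho> i)) = \<alpha> i"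
  shows "algebra_isomorphic (ring_of_type_algebra :: 'm ring) (poly_quot p) (poly_quot q)"
proof (rule algebra_isomorphic_poly_quotI)
  have X: "map_poly to_ac (h - [:0, 1:]) = map_poly to_ac h - [:0, 1:]" for h :: "'m poly"
    by (rule poly_eqI) (simp add: coeff_map_poly coeff_pCons split: nat.splits)
  have \<beta>: "\<exists>l\<in>{1..n}. \<beta> i = \<beta> (\<rho> l)" if "i \<in> {1..n}" for i
    using that permutes_image[OF \<rho>] by (metis imageE)
  have \<rho>i: "\<rho> i \<in> {1..n}" if "i \<in> {1..n}" for i
    using that permutes_in_image[OF \<rho>] by blast
  show "q dvd pcompose p d"
  proof (rule roots_enum_dvd[OF q(1) n q(2)])
    fix i assume "i \<in> {1..n}"
    then obtain l where "l \<in> {1..n}" "\<beta> i = \<beta> (\<rho> l)" using \<beta> by blast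
    then show "poly (map_poly to_ac (pcompose p d)) (\<beta> i) = 0"
      using roots_enum_poly[OF p(1)] by (auto simp: map_poly_to_ac_pcompose poly_pcompose d)
  qed
  show "p dvd pcompose q c"
  proof (rule roots_enum_dvd[OF p(1) n p(2)])
    fix i assume "i \<in> {1..n}"
    then show "poly (map_poly to_ac (pcompose q c)) (\<alpha> i) = 0"
      using roots_enum_poly[OF q(1)] \<rho>i by (auto simp: map_poly_to_ac_pcompose poly_pcompose c)
  qed
  show "q dvd pcompose c d - [:0, 1:]"
  proof (rule roots_enum_dvd[OF q(1) n q(2)])
    fix i assume "i \<in> {1..n}"
    then obtain l where "l \<in> {1..n}" "\<beta> i = \<beta> (\<rho> l)" using \<beta> by blast
    then show "poly (map_poly to_ac (pcompose c d - [:0, 1:])) (\<beta> i) = 0"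
      by (simp add: X map_poly_to_ac_pcompose poly_pcompose c d)
  qed
  show "p dvd pcompose d c - [:0, 1:]"
  proof (rule roots_enum_dvd[OF p(1) n p(2)])
    fix i assume "i \<in> {1..n}"
    then show "poly (map_poly to_ac (pcompose d c - [:0, 1:])) (\<alpha> i) = 0"
      by (simp add: X map_poly_to_ac_pcompose poly_pcompose c d)
  qed
qed

text \<open>On roots \<open>d\<close> acts by an index map \<mu>, because \<open>p(d)\<close>
  vanishes at the roots of \<open>q\<close>. As \<open>c\<close> undoes \<open>d\<close> there,
  \<mu> is injective, hence a permutation, and \<open>c\<close> realises its inverse \<rho>.\<close>

lemma isomorphic_imp_interp:
  fixes p q :: "'m::field poly"
  assumes n: "n > 0" and p: "roots_enum n p \<alpha>" "inj_on \<alpha> {1..n}"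
    and q: "roots_enum n q \<beta>" "inj_on \<beta> {1..n}"
    and iso: "algebra_isomorphic (ring_of_type_algebra :: 'm ring) (poly_quot p) (poly_quot q)"
  obtains \<rho> c where "\<rho> permutes {1..n}" "map_poly to_ac c = interp n \<alpha> (\<beta> \<circ> \<rho>)"
proof -
  obtain c d where pd: "q dvd pcompose p d" and cd: "q dvd pcompose c d - [:0, 1:]"
    using algebra_isomorphic_poly_quotE[OF iso] .
  have vanish: "poly (map_poly to_ac g) (\<beta> i) = 0" if "q dvd g" "i \<in> {1..n}" for g i
    using that roots_enum_poly[OF q(1), of "\<beta> i"] by (auto simp: map_poly_to_ac_mult elim!: dvdE)
  have "\<exists>l\<in>{1..n}. poly (map_poly to_ac d) (\<beta> i) = \<alpha> l" if "i \<in> {1..n}" for i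
    using vanish[OF pd that] roots_enum_poly[OF p(1)]
    by (simp add: map_poly_to_ac_pcompose poly_pcompose)
  then obtain \<mu> where \<mu>: "\<And>i. i \<in> {1..n} \<Longrightarrow> \<mu> i \<in> {1..n}"
    "\<And>i. i \<in> {1..n} \<Longrightarrow> poly (map_poly to_ac d) (\<beta> i) = \<alpha> (\<mu> i)" by metis
  have c: "poly (map_poly to_ac c) (\<alpha> (\<mu> i)) = \<beta> i" if i: "i \<in> {1..n}" for i
  proof -
    have "map_poly to_ac (pcompose c d)
        = map_poly to_ac (pcompose c d - [:0, 1:]) + map_poly to_ac [:0, 1:]"
      by (simp flip: map_poly_to_ac_add)
    then have "poly (map_poly to_ac (pcompose c d)) (\<beta> i) = \<beta> i"
      using vanish[OF cd i] by (simp add: map_poly_pCons)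
    then show ?thesis using \<mu>(2)[OF i] by (simp add: map_poly_to_ac_pcompose poly_pcompose)
  qed
  have "inj_on \<mu> {1..n}"
    by (rule inj_onI) (metis c inj_onD[OF q(2)])
  moreover have "\<mu> ` {1..n} = {1..n}"
    using calculation \<mu>(1) by (intro endo_inj_surj) auto
  ultimately have bij: "bij_betw \<mu> {1..n} {1..n}" by (simp add: bij_betw_def)
  \<comment> \<open>Outside \<open>{1..n}\<close> the map must be the identity in order to be a
    permutation in the sense of \<open>permutes\<close>.\<close>
  define \<rho> where "\<rho> i = (if i \<in> {1..n} then inv_into {1..n} \<mu> i else i)" for i
  have "bij_betw \<rho> {1..n} {1..n} \<longleftrightarrow> bij_betw (inv_into {1..n} \<mu>) {1..n} {1..n}"
    by (rule bij_betw_cong) (simp add: \<rho>_def)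
  then have "\<rho> permutes {1..n}"
    using bij_betw_inv_into[OF bij] by (intro bij_imp_permutes) (auto simp: \<rho>_def)
  \<comment> \<open>Reduction modulo \<open>p\<close> brings the degree below \<open>n\<close>
    without changing the values at the roots of \<open>p\<close>.\<close>
  moreover have "map_poly to_ac (c mod p) = interp n \<alpha> (\<beta> \<circ> \<rho>)"
  proof (rule interp_unique[OF p(2)])
    have "p \<noteq> 0" using roots_enum_degree[OF p(1)] n by auto
    then show "degree (map_poly to_ac (c mod p)) < n"
      using degree_mod_less'[of p c] n roots_enum_degree[OF p(1)]
      by (cases "c mod p = 0") (auto simp: degree_map_poly)
    fix i assume i: "i \<in> {1..n}"
    have \<rho>i: "\<rho> i \<in> {1..n}" "\<mu> (\<rho> i) = i"
      using i bij_betw_inv_into_right[OF bij i] bij_betwE[OF bij_betw_inv_into[OF bij]]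
      by (auto simp: \<rho>_def)
    show "poly (map_poly to_ac (c mod p)) (\<alpha> i) = (\<beta> \<circ> \<rho>) i"
      using c[OF \<rho>i(1)] \<rho>i(2) roots_enum_poly_mod[OF p(1) i, of c] by simp
  qed
  ultimately show ?thesis by (rule that)
qed

theorem theorem3p8:
  fixes k :: "'m::field set"
    and n j :: nat
    and a b :: "nat \<Rightarrow> 'm"
    and \<alpha> \<beta> :: "nat \<Rightarrow> 'm alg_closure"
  assumes "n \<ge> 3"
    and "subfield k (ring_of_type_algebra :: 'm ring)"
    and "infinite (UNIV :: 'm set)"
    and "no_multiple_root (f_poly n a)"
    and "no_multiple_root (f_poly n b)"
    and "roots_enum n (f_poly n a) \<alpha>"
    and "roots_enum n (f_poly n b) \<beta>"
    and "j \<le> n - 1"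
    and "no_multiple_root (F_poly n j \<alpha> \<beta>)"
  shows "(\<exists>x. poly (F_poly n j \<alpha> \<beta>) x = 0) \<longleftrightarrow>
    algebra_isomorphic (ring_of_type_algebra :: 'm ring)
      (poly_quot (f_poly n a)) (poly_quot (f_poly n b))"
proof -
  have n: "n > 0" and j: "j < n" using assms(1,8) by auto
  note inj = roots_enum_inj[OF assms(6,4)] roots_enum_inj[OF assms(7,5)]
  have coeffs: "coeff (\<Prod>i=1..n. [:- \<alpha> i, 1:]) k \<in> range to_ac"
    if "roots_enum n p \<alpha>" for p :: "'m poly" and \<alpha> k
    using that unfolding roots_enum_def by (metis coeff_map_poly rangeI to_ac_0)
  \<comment> \<open>The subfield \<open>K\<close> is the copy of the base field inside its algebraic
    closure.\<close>
  interpret root_tuples "range (to_ac :: 'm \<Rightarrow> _)" n \<alpha> \<beta>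
    by unfold_locales
      (use n inj coeffs assms(6,7) in
        \<open>auto simp flip: to_ac_diff to_ac_mult to_ac_inverse intro: range_eqI[of _ _ 1]\<close>)
  define u where "u \<rho> = coeff (interp n \<alpha> (\<beta> \<circ> \<rho>)) j" for \<rho>
  have u: "admissible u"
    unfolding u_def by (rule admissible_interp_forward)
  obtain F :: "'m poly" where F: "map_poly to_ac F = (\<Prod>\<rho>\<in>P. [:- u \<rho>, 1:])"
    using map_poly_to_ac_surj[OF coeff_resolvent_in_K[OF u]] .
  have "F_closure n j \<alpha> \<beta> = (\<Prod>\<rho>\<in>P. [:- u \<rho>, 1:])"
    by (simp add: F_closure_def u_def vandermonde_sol_eq[OF inj(1) j])
  \<comment> \<open>The description defining \<open>F_poly\<close> is resolved: the descended
    \<open>F\<close> satisfies it, and coefficientwise \<open>to_ac\<close> is injective.\<close>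
  then have F_poly: "F_poly n j \<alpha> \<beta> = F"
    by (simp only: F_poly_def F[symmetric] map_poly_to_ac_inj the_eq_trivial)
  have root: "poly F x = 0 \<longleftrightarrow> (\<exists>\<rho>\<in>P. u \<rho> = to_ac x)" for x
  proof -
    have "poly F x = 0 \<longleftrightarrow> poly (map_poly to_ac F) (to_ac x) = 0"
      by (simp add: poly_map_poly_to_ac)
    also have "\<dots> \<longleftrightarrow> (\<exists>\<rho>\<in>P. to_ac x - u \<rho> = 0)"
      using finite_P by (simp add: F poly_prod)
    finally show ?thesis by auto
  qed
  have inj_u: "inj_on u P"
    using assms(9) finite_P
    by (intro rsquarefree_prod_linear_inj) (simp_all add: no_multiple_root_def F_poly F)
  show ?thesis unfolding F_poly
  proof
    assume "\<exists>x. poly F x = 0"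
    then obtain \<rho> where \<rho>: "\<rho> \<in> P" "u \<rho> \<in> range to_ac" unfolding root by force
    \<comment> \<open>By \<open>inj_u\<close> the root is simple, so one coefficient in the base
      field brings down all coefficients of both interpolants.\<close>
    have descend: "w \<rho> \<in> range to_ac" if "admissible w" for w
      by (rule simple_value_determines[OF u that \<rho>]) (use inj_u \<rho>(1) in \<open>auto dest: inj_onD\<close>)
    obtain c :: "'m poly" where c: "map_poly to_ac c = interp n \<alpha> (\<beta> \<circ> \<rho>)"
      using map_poly_to_ac_surj[OF descend[OF admissible_interp_forward]] .
    obtain d :: "'m poly" where d: "map_poly to_ac d = interp n (\<beta> \<circ> \<rho>) \<alpha>"
      using map_poly_to_ac_surj[OF descend[OF admissible_interp_backward]] .
    show "algebra_isomorphic (ring_of_type_algebra :: 'm ring)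
        (poly_quot (f_poly n a)) (poly_quot (f_poly n b))"
    proof (rule interpolants_imp_isomorphic[OF n assms(6) inj(1) assms(7) inj(2)])
      show "\<rho> permutes {1..n}" using \<rho> by simp
      show "poly (map_poly to_ac c) (\<alpha> i) = \<beta> (\<rho> i)" if "i \<in> {1..n}" for i
        using poly_interp[OF inj(1) that, of "\<beta> \<circ> \<rho>"] by (simp add: c)
      show "poly (map_poly to_ac d) (\<beta> (\<rho> i)) = \<alpha> i" if "i \<in> {1..n}" for i
        using poly_interp[OF inj_comp_permutes[OF inj(2) \<rho>(1)] that, of \<alpha>] by (simp add: d)
    qed
  next
    assume "algebra_isomorphic (ring_of_type_algebra :: 'm ring)
        (poly_quot (f_poly n a)) (poly_quot (f_poly n b))"
    then obtain \<rho> c where "\<rho> permutes {1..n}" and c: "map_poly to_ac c = interp n \<alpha> (\<beta> \<circ> \<rho>)"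
      by (rule isomorphic_imp_interp[OF n assms(6) inj(1) assms(7) inj(2)])
    \<comment> \<open>The interpolant is defined over the base field, so its \<open>j\<close>-th
      coefficient is the required root.\<close>
    then have "poly F (coeff c j) = 0"
      unfolding root by (intro bexI[of _ \<rho>]) (simp_all add: u_def coeff_map_poly flip: c)
    then show "\<exists>x. poly F x = 0" by blast
  qed
qed

end
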